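(* Let $(\xi,\mu,\eta)$ be a linear representation over $\Sigma=\{a_1,\dots,a_\ell,b\}$ satisfying the standing assumptions in the context, assume that the matrix $M=A_1+\cdots+A_\ell+B$ is primitive, and let $\lambda$ be its Perron-Frobenius eigenvalue. Let $\Psi_n(\mathbf{t})=\mathbb{E}[e^{\mathbf{t}\cdot\mathbf{Y}_n}]$ be the moment generating function of the associated symbol statistics $\mathbf{Y}_n$, and let $y(\mathbf{t})$ be the Perron-Frobenius eigenvalue of $M(\mathbf{t})=A_1e^{t_1}+\cdots+A_\ell e^{t_\ell}+B$. Then there exists an analytic strictly positive function $r:\mathbb{R}^\ell\to\mathbb{R}_+$, satisfying $r(\mathbf{0})=1$, such that for any $\mathbf{t}\in\mathbb{R}^\ell$ we have, as $n\to\infty$, $$\Psi_n(\mathbf{t})=r(\mathbf{t})\left(\frac{y(\mathbf{t})}{\lambda}\right)^n\left(1+O(\varepsilon_{\mathbf{t}}^n)\right)$$ for some $\varepsilon_{\mathbf{t}}\in(0,1)$.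
   Context: Model. Let $\ell\ge 1$, $m\ge 1$ be integers, $\Sigma=\{a_1,\dots,a_\ell,b\}$ a finite alphabet with $\ell+1$ symbols, $\mathbb{R}_+=[0,\infty)$. Fix column vectors $\xi,\eta\in\mathbb{R}_+^m$ and matrices $A_1,\dots,A_\ell,B\in\mathbb{R}_+^{m\times m}$. Let $\mu$ be the monoid morphism from the set $\Sigma^*$ of all words over $\Sigma$ to $\mathbb{R}_+^{m\times m}$ with $\mu(a_i)=A_i$, $\mu(b)=B$. The triple $(\xi,\mu,\eta)$ is called a linear representation. A prime denotes transposition. Put $M=A_1+\cdots+A_\ell+B$. Standing assumptions: all of $A_1,\dots,A_\ell,B$ are nonzero matrices, and for every sufficiently large $n$ there is a word $w$ of length $n$ with $\xi'\mu(w)\eta>0$ (so $\xi\ne 0\ne\eta$ and $\xi'M^n\eta>0$ for all large $n$). For such $n$, the set $\Sigma^n$ of words of length $n$ carries the probability measure $\Pr(w)=\dfrac{\xi'\mu(w)\eta}{\xi'M^n\eta}$, and $\mathbf{Y}_n=(|w|_{a_1},\dots,|w|_{a_\ell})$, where $w$ is random in $\Sigma^n$ with law $\Pr$ and $|w|_{x}$ is the number of occurrences of $x$ in $w$. Thus $\Psi_n(\mathbf{t})=\dfrac{\xi'M(\mathbf{t})^n\eta}{\xi'M^n\eta}$. A matrix $T\in\mathbb{R}_+^{m\times m}$ is primitive if $T^k$ has all entries strictly positive for some $k\ge 1$; its Perron-Frobenius eigenvalue is its unique eigenvalue of largest modulus, which is real, positive and simple. If $M$ is primitive then $M(\mathbf{t})$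 is primitive for all $\mathbf{t}\in\mathbb{R}^\ell$, so $y(\mathbf{t})$ is defined on all of $\mathbb{R}^\ell$, and $y(\mathbf{0})=\lambda$. The constant in $O(\varepsilon_{\mathbf{t}}^n)$ may depend on $\mathbf{t}$. *)

theory Defs
  imports "HOL-Analysis.Analysis" "HOL-Library.Landau_Symbols"
begin

text \<open>
  The alphabet with symbols \<open>a\<^sub>i\<close> (\<open>i :: 'l\<close>) and \<open>b\<close> is the type \<open>'l option\<close>:
  \<open>Some i\<close> is \<open>a\<^sub>i\<close> and \<open>None\<close> is \<open>b\<close>. Words are lists.
\<close>

primrec symbol_matrix ::
  "('l \<Rightarrow> real^'m^'m) \<Rightarrow> real^'m^'m \<Rightarrow> 'l option \<Rightarrow> real^'m^'m" where
  "symbol_matrix A B None = B"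
| "symbol_matrix A B (Some i) = A i"

text \<open>The monoid morphism \<open>\<mu>\<close> from words to matrices with \<open>\<mu> a\<^sub>i = A i\<close> and \<open>\<mu> b = B\<close>.\<close>

primrec word_matrix ::
  "('l \<Rightarrow> real^'m^'m) \<Rightarrow> real^'m^'m \<Rightarrow> 'l option list \<Rightarrow> real^'m^'m" where
  "word_matrix A B [] = mat 1"
| "word_matrix A B (x # w) = symbol_matrix A B x ** word_matrix A B w"

text \<open>Power for the matrix product; the operation \<open>^\<close> of type class \<open>power\<close> acts entrywise here.\<close>

primrec matrix_power :: "real^'m^'m \<Rightarrow> nat \<Rightarrow> real^'m^'m" where
  "matrix_power T 0 = mat 1"
| "matrix_power T (Suc n) = T ** matrix_power T n"

definition primitive_matrix :: "real^'m^'m \<Rightarrow> bool" where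
  "primitive_matrix T \<longleftrightarrow>
     0 \<le> T \<and> (\<exists>k\<ge>1. \<forall>i j. matrix_power T k $ i $ j > 0)"

definition complex_eigenvalue :: "real^'m^'m \<Rightarrow> complex \<Rightarrow> bool" where
  "complex_eigenvalue T z \<longleftrightarrow>
     (\<exists>v. v \<noteq> 0 \<and> map_matrix complex_of_real T *v v = z *s v)"

text \<open>
  The eigenvalue whose modulus strictly exceeds that of every other complex eigenvalue.
  It is only meaningful if such an eigenvalue exists and is real, as for primitive matrices.
\<close>

definition perron_frobenius_eigenvalue :: "real^'m^'m \<Rightarrow> real" where
  "perron_frobenius_eigenvalue T =
     (THE x. complex_eigenvalue T (complex_of_real x) \<and>
        (\<forall>z. complex_eigenvalue T z \<and> z \<noteq> complex_of_real x
            \<longrightarrow> cmod z < cmod (complex_of_real x)))"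

definition total_matrix :: "('l::finite \<Rightarrow> real^'m^'m) \<Rightarrow> real^'m^'m \<Rightarrow> real^'m^'m" where
  "total_matrix A B = (\<Sum>i\<in>UNIV. A i) + B"

definition tilted_matrix ::
  "('l::finite \<Rightarrow> real^'m^'m) \<Rightarrow> real^'m^'m \<Rightarrow> real^'l \<Rightarrow> real^'m^'m" where
  "tilted_matrix A B t = (\<Sum>i\<in>UNIV. exp (t $ i) *\<^sub>R A i) + B"

definition words :: "nat \<Rightarrow> 'a list set" where
  "words n = {w. length w = n}"

definition word_weight ::
  "real^'m \<Rightarrow> ('l \<Rightarrow> real^'m^'m) \<Rightarrow> real^'m^'m \<Rightarrow> real^'m \<Rightarrow> 'l option list \<Rightarrow> real" where
  "word_weight \<xi> A B \<eta> w = \<xi> \<bullet> (word_matrix A B w *v \<eta>)"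

text \<open>
  The law of the random word of length \<open>n\<close>. For the finitely many \<open>n\<close> at which the normalising
  constant \<open>\<xi>' M\<^sup>n \<eta>\<close> may vanish, division by zero makes this the zero measure.
\<close>

definition word_measure ::
  "real^'m \<Rightarrow> ('l::finite \<Rightarrow> real^'m^'m) \<Rightarrow> real^'m^'m \<Rightarrow> real^'m \<Rightarrow> nat
     \<Rightarrow> 'l option list measure" where
  "word_measure \<xi> A B \<eta> n =
     point_measure (words n)
       (\<lambda>w. ennreal (word_weight \<xi> A B \<eta> w /
                      (\<xi> \<bullet> (matrix_power (total_matrix A B) n *v \<eta>))))"

definition symbol_counts :: "'l::finite option list \<Rightarrow> real^'l" where
  "symbol_counts w = (\<chi> i. real (count_list w (Some i)))"

text \<open>The moment generating function \<open>\<Psi>\<^sub>n\<close> of the symbol counts of the random word.\<close>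

definition symbol_mgf ::
  "real^'m \<Rightarrow> ('l::finite \<Rightarrow> real^'m^'m) \<Rightarrow> real^'m^'m \<Rightarrow> real^'m \<Rightarrow> nat \<Rightarrow> real^'l \<Rightarrow> real" where
  "symbol_mgf \<xi> A B \<eta> n t =
     (LINT w|word_measure \<xi> A B \<eta> n. exp (t \<bullet> symbol_counts w))"

text \<open>
  Real analyticity in several variables: near every point the function is the sum of an
  (unconditionally convergent) power series indexed by multi-indices \<open>\<alpha> :: 'l \<Rightarrow> nat\<close>.
\<close>

definition real_analytic :: "(real^'l::finite \<Rightarrow> real) \<Rightarrow> bool" where
  "real_analytic f \<longleftrightarrow>
     (\<forall>x. \<exists>c :: ('l \<Rightarrow> nat) \<Rightarrow> real. \<exists>\<rho>>0. \<forall>h. (\<forall>i. \<bar>h $ i\<bar> < \<rho>) \<longrightarrow>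
        ((\<lambda>\<alpha>. c \<alpha> * (\<Prod>i\<in>UNIV. (h $ i) ^ \<alpha> i)) has_sum f (x + h)) UNIV)"

end

theory Submission
  imports Defs
begin

text \<open>
  By primitivity \<open>\<xi>' M(t)\<^sup>n \<eta> = y(t)\<^sup>n (c(t) + O(\<epsilon>\<^sup>n))\<close> with
  \<open>c(t) = (\<xi>' v\<^sub>t) (u\<^sub>t' \<eta>) / (u\<^sub>t' v\<^sub>t)\<close> for the positive right and left eigenvectors \<open>v\<^sub>t\<close>, \<open>u\<^sub>t\<close>
  of \<open>M(t)\<close>, and \<open>r(t) = c(t) / c(0)\<close>. The value \<open>c(t)\<close> does not depend on the scaling of the eigenvectors,
  so for analyticity it suffices to find near each \<open>t\<^sub>0\<close> some analytic eigenvectors. A high power of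
  \<open>M(t\<^sub>0) / y(t\<^sub>0)\<close> is close to the rank one matrix \<open>v u'\<close> with \<open>u' v = 1\<close>; writing the same power of
  \<open>M(t\<^sub>0 + h) / y(t\<^sub>0)\<close> as \<open>v u' + E(h)\<close>, an eigenvector is the fixed point of
  \<open>V \<mapsto> v + E V - (u' E V) V\<close>, which is a contraction on power series in \<open>h\<close>.
\<close>

section \<open>Convergent power series in several variables\<close>

text \<open>The perturbation argument wants a matrix close to rank one, and M(t) itself may be far
  from that; hence the detour through a power. Its price is that the fixed point is only known to be
  an eigenvector of M(t)^N. Positivity repairs this: a positive eigenvector of a power of a
  primitive matrix is a multiple of the Perron vector. The choices are nested. The admissible size
  \<open>\<delta>\<close> of E depends only on u, v and the dimension. The exponent N then brings
  E(0) within half of it. The radius is shrunk last, which works because the coefficient norm of a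
  power series tends to the modulus of its value at the origin. One estimate, geometric decay
  relative to y^n on the hyperplane orthogonal to u, serves three times: for the error term, for
  strict dominance over all other complex eigenvalues (which is what the definition of the
  Perron-Frobenius eigenvalue by \<open>THE\<close> asks for), and for the uniqueness of the
  positive eigenvector.\<close>

definition multi_degree :: "('l::finite \<Rightarrow> nat) \<Rightarrow> nat" where
  "multi_degree \<alpha> = (\<Sum>i\<in>UNIV. \<alpha> i)"

definition monomial_at :: "real^'l::finite \<Rightarrow> ('l \<Rightarrow> nat) \<Rightarrow> real" where
  "monomial_at h \<alpha> = (\<Prod>i\<in>UNIV. (h $ i) ^ \<alpha> i)"

definition cube :: "real \<Rightarrow> (real^'l::finite) set" where
  "cube \<rho> = {h. \<forall>i. \<bar>h $ i\<bar> \<le> \<rho>}"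

text \<open>The weighted \<open>\<ell>\<^sub>1\<close> norm of the coefficients, here bounded by \<open>K\<close>, is submultiplicative and complete, so
  fixed point arguments can be carried out directly on power series.\<close>

definition power_series_le :: "real \<Rightarrow> real \<Rightarrow> (real^'l::finite \<Rightarrow> real) \<Rightarrow> bool" where
  "power_series_le \<rho> K f \<longleftrightarrow>
     (\<exists>c S. ((\<lambda>\<alpha>. \<bar>c \<alpha>\<bar> * \<rho> ^ multi_degree \<alpha>) has_sum S) UNIV \<and> S \<le> K \<and>
        (\<forall>h\<in>cube \<rho>. ((\<lambda>\<alpha>. c \<alpha> * monomial_at h \<alpha>) has_sum f h) UNIV))"

lemma monomial_at_bound:
  assumes "h \<in> cube \<rho>"
  shows "\<bar>monomial_at h \<alpha>\<bar> \<le> \<rho> ^ multi_degree \<alpha>"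
proof -
  have "\<bar>monomial_at h \<alpha>\<bar> = (\<Prod>i\<in>UNIV. \<bar>h $ i\<bar> ^ \<alpha> i)"
    by (simp add: monomial_at_def abs_prod power_abs)
  also have "\<dots> \<le> (\<Prod>i\<in>UNIV. \<rho> ^ \<alpha> i)"
    using assms by (intro prod_mono) (auto simp: cube_def intro!: power_mono)
  also have "\<dots> = \<rho> ^ multi_degree \<alpha>"
    by (simp add: multi_degree_def power_sum)
  finally show ?thesis .
qed

lemma monomial_at_add: "monomial_at h (\<lambda>i. \<alpha> i + \<beta> i) = monomial_at h \<alpha> * monomial_at h \<beta>"
  by (simp add: monomial_at_def power_add prod.distrib)

lemma multi_degree_add: "multi_degree (\<lambda>i. \<alpha> i + \<beta> i) = multi_degree \<alpha> + multi_degree \<beta>"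
  by (simp add: multi_degree_def sum.distrib)

lemma has_sum_abs_le:
  fixes f g :: "'a \<Rightarrow> real"
  assumes "(f has_sum F) A" "(g has_sum G) A" "\<And>x. x \<in> A \<Longrightarrow> \<bar>f x\<bar> \<le> g x"
  shows "\<bar>F\<bar> \<le> G"
proof -
  have "((\<lambda>x. - f x) has_sum - F) A" using assms(1) by (rule has_sum_uminusI)
  from has_sum_mono[OF this assms(2)] has_sum_mono[OF assms(1,2)] show ?thesis
    using assms(3) by (simp add: abs_le_iff)
qed

lemma power_series_le_bound:
  assumes "power_series_le \<rho> K f" "h \<in> cube \<rho>"
  shows "\<bar>f h\<bar> \<le> K"
proof -
  obtain c S where S: "((\<lambda>\<alpha>. \<bar>c \<alpha>\<bar> * \<rho> ^ multi_degree \<alpha>) has_sum S) UNIV" "S \<le> K"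
    and f: "((\<lambda>\<alpha>. c \<alpha> * monomial_at h \<alpha>) has_sum f h) UNIV"
    using assms unfolding power_series_le_def by blast
  have "\<bar>f h\<bar> \<le> S"
    by (rule has_sum_abs_le[OF f S(1)])
       (use monomial_at_bound[OF assms(2)] in \<open>auto simp: abs_mult intro!: mult_left_mono\<close>)
  with S(2) show ?thesis by simp
qed

text \<open>Families indexed by an arbitrary type are regrouped by their exponents; products and
  infinite sums of power series are then mere re-indexings.\<close>

lemma power_series_le_regroup:
  fixes c :: "'j \<Rightarrow> real" and a :: "'j \<Rightarrow> 'l::finite \<Rightarrow> nat"
  assumes rho: "\<rho> > 0"
    and S: "((\<lambda>j. \<bar>c j\<bar> * \<rho> ^ multi_degree (a j)) has_sum S) UNIV" "S \<le> K"
    and f: "\<And>h. h \<in> cube \<rho> \<Longrightarrow> ((\<lambda>j. c j * monomial_at h (a j)) has_sum f h) UNIV"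
  shows "power_series_le \<rho> K f"
proof -
  have bij: "bij_betw snd (Sigma UNIV (\<lambda>\<alpha>. {j. a j = \<alpha>})) UNIV"
    by (auto simp: bij_betw_def inj_on_def image_iff)
  \<comment> \<open>The regrouped coefficient \<open>d\<close> is the sum of \<open>c\<close> over a
    fibre of \<open>a\<close>. Terms in a fibre may cancel, so \<open>d\<close> is only bounded by
    the sum \<open>e\<close> of absolute values, which carries exactly the total
    \<open>S\<close>.\<close>
  define d where "d \<alpha> = infsum c {j. a j = \<alpha>}" for \<alpha>
  define e where "e \<alpha> = infsum (\<lambda>j. \<bar>c j\<bar>) {j. a j = \<alpha>}" for \<alpha>
  have abs: "(\<lambda>j. \<bar>c j\<bar>) summable_on {j. a j = \<alpha>}" for \<alpha>
  proof -
    have "(\<lambda>j. \<bar>c j\<bar> * \<rho> ^ multi_degree (a j)) summable_on {j. a j = \<alpha>}"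
      using S(1) summable_on_subset_banach[OF has_sum_imp_summable] by blast
    hence "(\<lambda>j. \<bar>c j\<bar> * \<rho> ^ multi_degree \<alpha>) summable_on {j. a j = \<alpha>}"
      by (rule summable_on_cong[THEN iffD1, rotated]) auto
    thus ?thesis using rho by (subst (asm) summable_on_cmult_left') auto
  qed
  have e: "((\<lambda>j. \<bar>c j\<bar>) has_sum e \<alpha>) {j. a j = \<alpha>}" for \<alpha>
    unfolding e_def using abs by (rule has_sum_infsum)
  have d: "(c has_sum d \<alpha>) {j. a j = \<alpha>}" for \<alpha>
    unfolding d_def using abs summable_on_iff_abs_summable_on_real[of c]
    by (intro has_sum_infsum) auto
  have de: "\<bar>d \<alpha>\<bar> \<le> e \<alpha>" for \<alpha>
    by (rule has_sum_abs_le[OF d e]) simp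
  have e_sum: "((\<lambda>\<alpha>. e \<alpha> * \<rho> ^ multi_degree \<alpha>) has_sum S) UNIV"
  proof (rule has_sum_SigmaD)
    show "((\<lambda>p. \<bar>c (snd p)\<bar> * \<rho> ^ multi_degree (a (snd p))) has_sum S)
            (Sigma UNIV (\<lambda>\<alpha>. {j. a j = \<alpha>}))"
      using S(1) has_sum_reindex_bij_betw[OF bij] by fast
    fix \<alpha>
    have "((\<lambda>j. \<bar>c j\<bar> * \<rho> ^ multi_degree \<alpha>) has_sum e \<alpha> * \<rho> ^ multi_degree \<alpha>) {j. a j = \<alpha>}"
      by (rule has_sum_cmult_left[OF e])
    thus "((\<lambda>j. \<bar>c (snd (\<alpha>, j))\<bar> * \<rho> ^ multi_degree (a (snd (\<alpha>, j)))) has_sum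
             e \<alpha> * \<rho> ^ multi_degree \<alpha>) {j. a j = \<alpha>}"
      by (rule has_sum_cong[THEN iffD1, rotated]) auto
  qed
  have d_sum: "((\<lambda>\<alpha>. d \<alpha> * monomial_at h \<alpha>) has_sum f h) UNIV" if "h \<in> cube \<rho>" for h
  proof (rule has_sum_SigmaD)
    show "((\<lambda>p. c (snd p) * monomial_at h (a (snd p))) has_sum f h)
            (Sigma UNIV (\<lambda>\<alpha>. {j. a j = \<alpha>}))"
      using f[OF that] has_sum_reindex_bij_betw[OF bij] by fast
    fix \<alpha>
    have "((\<lambda>j. c j * monomial_at h \<alpha>) has_sum d \<alpha> * monomial_at h \<alpha>) {j. a j = \<alpha>}"
      by (rule has_sum_cmult_left[OF d])
    thus "((\<lambda>j. c (snd (\<alpha>, j)) * monomial_at h (a (snd (\<alpha>, j)))) has_sum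
             d \<alpha> * monomial_at h \<alpha>) {j. a j = \<alpha>}"
      by (rule has_sum_cong[THEN iffD1, rotated]) auto
  qed
  have "(\<lambda>\<alpha>. \<bar>d \<alpha>\<bar> * \<rho> ^ multi_degree \<alpha>) summable_on UNIV"
    by (rule summable_on_comparison_test[OF has_sum_imp_summable[OF e_sum]])
       (use rho de in \<open>auto intro!: mult_right_mono\<close>)
  then obtain S' where S': "((\<lambda>\<alpha>. \<bar>d \<alpha>\<bar> * \<rho> ^ multi_degree \<alpha>) has_sum S') UNIV"
    using summable_on_def by blast
  have "S' \<le> S"
    by (rule has_sum_mono[OF S' e_sum]) (use rho de in \<open>auto intro!: mult_right_mono\<close>)
  with S(2) S' d_sum show ?thesis unfolding power_series_le_def
    by (intro exI[of _ d] exI[of _ S']) auto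
qed

lemma power_series_le_mono: "power_series_le \<rho> K f \<Longrightarrow> K \<le> K' \<Longrightarrow> power_series_le \<rho> K' f"
  unfolding power_series_le_def by (meson order_trans)

lemma power_series_le_nonneg: "\<rho> \<ge> 0 \<Longrightarrow> power_series_le \<rho> K f \<Longrightarrow> 0 \<le> K"
  using power_series_le_bound[of \<rho> K f 0] by (auto simp: cube_def intro: order_trans[OF abs_ge_zero])

lemma power_series_le_cong: "power_series_le \<rho> K f \<Longrightarrow> (\<And>h. h \<in> cube \<rho> \<Longrightarrow> f h = g h) \<Longrightarrow> power_series_le \<rho> K g"
  unfolding power_series_le_def by metis

lemma power_series_le_const:
  assumes "\<rho> > 0" shows "power_series_le \<rho> \<bar>k\<bar> (\<lambda>_::real^'l::finite. k)"
proof (rule power_series_le_regroup[where c="\<lambda>_::unit. k" and a="\<lambda>_ _. 0" and S="\<bar>k\<bar>"])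
qed (use assms in \<open>auto simp: multi_degree_def monomial_at_def UNIV_unit intro!: has_sum_finiteI\<close>)

lemma power_series_le_coord:
  assumes "\<rho> > 0" shows "power_series_le \<rho> \<rho> (\<lambda>h::real^'l::finite. h $ i)"
proof (rule power_series_le_regroup[where c="\<lambda>_::unit. 1" and a="\<lambda>_ j. if j = i then 1 else 0" and S="\<rho>"])
qed (use assms in \<open>auto simp: multi_degree_def monomial_at_def UNIV_unit if_distrib[of "\<lambda>x. _ ^ x"]
       cong: if_cong intro!: has_sum_finiteI\<close>)

lemma power_series_le_mult:
  fixes f g :: "real^'l::finite \<Rightarrow> real"
  assumes rho: "\<rho> > 0" and "power_series_le \<rho> K f" "power_series_le \<rho> L g"
  shows "power_series_le \<rho> (K * L) (\<lambda>h. f h * g h)"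
proof -
  obtain c S where S: "((\<lambda>\<alpha>. \<bar>c \<alpha>\<bar> * \<rho> ^ multi_degree \<alpha>) has_sum S) UNIV" "S \<le> K"
    and f: "\<And>h. h\<in>cube \<rho> \<Longrightarrow> ((\<lambda>\<alpha>. c \<alpha> * monomial_at h \<alpha>) has_sum f h) UNIV"
    using assms unfolding power_series_le_def by blast
  obtain d T where T: "((\<lambda>\<alpha>. \<bar>d \<alpha>\<bar> * \<rho> ^ multi_degree \<alpha>) has_sum T) UNIV" "T \<le> L"
    and g: "\<And>h. h\<in>cube \<rho> \<Longrightarrow> ((\<lambda>\<alpha>. d \<alpha> * monomial_at h \<alpha>) has_sum g h) UNIV"
    using assms unfolding power_series_le_def by blast
  have pos: "S \<ge> 0" "T \<ge> 0"
    using has_sum_nonneg[OF S(1)] has_sum_nonneg[OF T(1)] rho by auto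
  define w where "w \<alpha> = \<rho> ^ multi_degree \<alpha>" for \<alpha> :: "'l \<Rightarrow> nat"
  have w: "w \<alpha> \<ge> 0" for \<alpha> using rho by (simp add: w_def)
  \<comment> \<open>Absolute summability over pairs of exponents, with weights at the full radius.
    It dominates the double series at every point of the cube, so the Cauchy product may be summed
    in any order.\<close>
  have sumab: "(\<lambda>p. (\<bar>c (fst p)\<bar> * w (fst p)) * (\<bar>d (snd p)\<bar> * w (snd p))) summable_on Sigma UNIV (\<lambda>_. UNIV)"
  proof (rule summable_on_SigmaI)
    show "((\<lambda>y. (\<bar>c (fst (x, y))\<bar> * w (fst (x, y))) * (\<bar>d (snd (x, y))\<bar> * w (snd (x, y)))) has_sum
      (\<bar>c x\<bar> * w x) * T) UNIV" for x
      using has_sum_cmult_right[OF T(1)] by (simp add: w_def)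
    show "(\<lambda>x. (\<bar>c x\<bar> * w x) * T) summable_on UNIV"
      using has_sum_cmult_left[OF S(1)] unfolding w_def by (rule has_sum_imp_summable)
  qed (use w in auto)
  show ?thesis
  proof (rule power_series_le_regroup[where c="\<lambda>p. c (fst p) * d (snd p)" and a="\<lambda>p i. fst p i + snd p i" and S="S * T"])
    have "((\<lambda>p. (\<bar>c (fst p)\<bar> * w (fst p)) * (\<bar>d (snd p)\<bar> * w (snd p))) has_sum S * T) (Sigma UNIV (\<lambda>_. UNIV))"
    proof (rule has_sum_SigmaI[OF _ _ sumab])
      show "((\<lambda>y. (\<bar>c (fst (x, y))\<bar> * w (fst (x, y))) * (\<bar>d (snd (x, y))\<bar> * w (snd (x, y)))) has_sum
        (\<bar>c x\<bar> * w x) * T) UNIV" for x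
        using has_sum_cmult_right[OF T(1)] by (simp add: w_def)
      show "((\<lambda>x. (\<bar>c x\<bar> * w x) * T) has_sum S * T) UNIV"
        using has_sum_cmult_left[OF S(1)] unfolding w_def .
    qed
    thus "((\<lambda>p. \<bar>c (fst p) * d (snd p)\<bar> * \<rho> ^ multi_degree (\<lambda>i. fst p i + snd p i)) has_sum S * T) UNIV"
      by (simp add: multi_degree_add power_add abs_mult w_def mult_ac)
    show "S * T \<le> K * L" using S(2) T(2) pos by (intro mult_mono) auto
    fix h :: "real^'l" assume h: "h \<in> cube \<rho>"
    have "((\<lambda>p. (c (fst p) * monomial_at h (fst p)) * (d (snd p) * monomial_at h (snd p)))
             has_sum f h * g h) (Sigma UNIV (\<lambda>_. UNIV))"
    proof (rule has_sum_SigmaI)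
      show "((\<lambda>y. (c (fst (x, y)) * monomial_at h (fst (x, y))) * (d (snd (x, y)) * monomial_at h (snd (x, y)))) has_sum
        (c x * monomial_at h x) * g h) UNIV" for x
        using has_sum_cmult_right[OF g[OF h]] by simp
      show "((\<lambda>x. (c x * monomial_at h x) * g h) has_sum f h * g h) UNIV"
        using has_sum_cmult_left[OF f[OF h]] .
      show "(\<lambda>p. (c (fst p) * monomial_at h (fst p)) * (d (snd p) * monomial_at h (snd p))) summable_on UNIV \<times> UNIV"
        by (subst summable_on_iff_abs_summable_on_real, rule Infinite_Sum.abs_summable_on_comparison_test'[OF sumab])
           (use monomial_at_bound[OF h] w in \<open>auto simp: abs_mult w_def intro!: mult_mono\<close>)
    qed
    thus "((\<lambda>p. c (fst p) * d (snd p) * monomial_at h (\<lambda>i. fst p i + snd p i)) has_sum f h * g h) UNIV"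
      by (simp add: monomial_at_add mult_ac)
  qed (use rho in auto)
qed

text \<open>Completeness of the coefficient norm in the form in which it is used: a series of power
  series with summable norms. Finite sums (padded with zeros), the exponential, the geometric series
  and the limit of the fixed point iteration are all instances.\<close>

lemma power_series_le_sums:
  fixes f :: "nat \<Rightarrow> real^'l::finite \<Rightarrow> real"
  assumes rho: "\<rho> > 0" and f: "\<And>k. power_series_le \<rho> (K k) (f k)" and K: "K sums L"
    and g: "\<And>h. h \<in> cube \<rho> \<Longrightarrow> (\<lambda>k. f k h) sums g h"
  shows "power_series_le \<rho> L g"
proof -
  have "\<forall>k. \<exists>c S. ((\<lambda>\<alpha>. \<bar>c \<alpha>\<bar> * \<rho> ^ multi_degree \<alpha>) has_sum S) UNIV \<and> S \<le> K k \<and>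
    (\<forall>h\<in>cube \<rho>. ((\<lambda>\<alpha>. c \<alpha> * monomial_at h \<alpha>) has_sum f k h) UNIV)"
    using f unfolding power_series_le_def by (rule allI)
  then obtain c S where cS: "\<forall>k. ((\<lambda>\<alpha>. \<bar>c k \<alpha>\<bar> * \<rho> ^ multi_degree \<alpha>) has_sum S k) UNIV \<and> S k \<le> K k \<and>
    (\<forall>h\<in>cube \<rho>. ((\<lambda>\<alpha>. c k \<alpha> * monomial_at h \<alpha>) has_sum f k h) UNIV)"
    unfolding choice_iff by (elim exE)
  have S: "((\<lambda>\<alpha>. \<bar>c k \<alpha>\<bar> * \<rho> ^ multi_degree \<alpha>) has_sum S k) UNIV" "S k \<le> K k" for k
    using cS by auto
  have c: "((\<lambda>\<alpha>. c k \<alpha> * monomial_at h \<alpha>) has_sum f k h) UNIV" if "h\<in>cube \<rho>" for k h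
    using cS that by auto
  have S0: "S k \<ge> 0" for k using has_sum_nonneg[OF S(1)] rho by auto
  have K0: "K k \<ge> 0" for k using S0 S(2) order_trans by blast
  have Ksum: "(K has_sum L) UNIV"
    using K K0 by (intro norm_summable_imp_has_sum) (auto simp: sums_iff)
  have "S summable_on UNIV"
    by (rule summable_on_comparison_test[OF has_sum_imp_summable[OF Ksum]]) (use S S0 in auto)
  then obtain S' where S': "(S has_sum S') UNIV" using summable_on_def by blast
  have "S' \<le> L" using has_sum_mono[OF S' Ksum] S(2) by auto
  define w where "w \<alpha> = \<rho> ^ multi_degree \<alpha>" for \<alpha> :: "'l \<Rightarrow> nat"
  have w: "w \<alpha> \<ge> 0" for \<alpha> using rho by (simp add: w_def)
  have sumab: "(\<lambda>p. \<bar>c (fst p) (snd p)\<bar> * w (snd p)) summable_on Sigma UNIV (\<lambda>_. UNIV)"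
    by (rule summable_on_SigmaI[where g=S])
       (use S(1) S' w in \<open>auto simp: w_def intro: has_sum_imp_summable\<close>)
  show ?thesis
  proof (rule power_series_le_regroup[where c="\<lambda>p. c (fst p) (snd p)" and a="\<lambda>p. snd p" and S="S'"])
    show "((\<lambda>p. \<bar>c (fst p) (snd p)\<bar> * \<rho> ^ multi_degree (snd p)) has_sum S') UNIV"
      using has_sum_SigmaI[where g=S, OF _ S' sumab] S(1) by (simp add: w_def)
    fix h :: "real^'l" assume h: "h \<in> cube \<rho>"
    have fs: "((\<lambda>k. f k h) has_sum g h) UNIV"
    proof (rule norm_summable_imp_has_sum[OF _ g[OF h]])
      show "summable (\<lambda>n. norm (f n h))"
        by (rule summable_comparison_test[OF _ sums_summable[OF K]])
           (use power_series_le_bound[OF f h] in auto)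
    qed
    have "((\<lambda>p. c (fst p) (snd p) * monomial_at h (snd p)) has_sum g h) (Sigma UNIV (\<lambda>_. UNIV))"
    proof (rule has_sum_SigmaI[OF _ fs])
      show "(\<lambda>p. c (fst p) (snd p) * monomial_at h (snd p)) summable_on UNIV \<times> UNIV"
        by (subst summable_on_iff_abs_summable_on_real, rule Infinite_Sum.abs_summable_on_comparison_test'[OF sumab])
           (use monomial_at_bound[OF h] w in \<open>auto simp: abs_mult w_def intro!: mult_mono\<close>)
    qed (use c[OF h] in auto)
    thus "((\<lambda>p. c (fst p) (snd p) * monomial_at h (snd p)) has_sum g h) UNIV" by simp
  qed (use rho \<open>S' \<le> L\<close> in auto)
qed

lemma power_series_le_add:
  assumes rho: "\<rho> > 0" and "power_series_le \<rho> K f" "power_series_le \<rho> L g"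
  shows "power_series_le \<rho> (K + L) (\<lambda>h. f h + g h)"
proof (rule power_series_le_sums[where f="\<lambda>k. if k = 0 then f else if k = 1 then g else (\<lambda>_. 0)"
      and K="\<lambda>k. if k = 0 then K else if k = 1 then L else 0"])
  show "power_series_le \<rho> (if k = 0 then K else if k = 1 then L else 0)
      (if k = 0 then f else if k = 1 then g else (\<lambda>_. 0))" for k :: nat
    using assms power_series_le_const[OF rho, of 0] by (cases "k = 0"; cases "k = 1") (simp_all del: One_nat_def)
  show "(\<lambda>k::nat. if k = 0 then K else if k = 1 then L else 0) sums (K + L)"
    using sums_finite[of "{0,1::nat}" "\<lambda>k. if k = 0 then K else if k = 1 then L else 0"] by simp
  show "(\<lambda>k::nat. (if k = 0 then f else if k = 1 then g else (\<lambda>_. 0)) h) sums (f h + g h)" for h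
    using sums_finite[of "{0,1::nat}" "\<lambda>k. (if k = 0 then f else if k = 1 then g else (\<lambda>_. 0)) h"] by simp
qed (use rho in auto)

lemma power_series_le_sum:
  assumes "\<rho> > 0" "finite I" "\<And>i. i \<in> I \<Longrightarrow> power_series_le \<rho> (K i) (f i)"
  shows "power_series_le \<rho> (\<Sum>i\<in>I. K i) (\<lambda>h. \<Sum>i\<in>I. f i h)"
  using assms(2,3)
proof (induction I rule: finite_induct)
  case empty
  then show ?case using power_series_le_const[OF assms(1), of 0] by simp
next
  case (insert x F)
  then show ?case using power_series_le_add[OF assms(1), of "K x" "f x"] by simp
qed

lemma power_series_le_cmult: "\<rho> > 0 \<Longrightarrow> power_series_le \<rho> K f \<Longrightarrow> power_series_le \<rho> (\<bar>k\<bar> * K) (\<lambda>h. k * f h)"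
  using power_series_le_mult[OF _ power_series_le_const] .

lemma power_series_le_power: "\<rho> > 0 \<Longrightarrow> power_series_le \<rho> K f \<Longrightarrow> power_series_le \<rho> (K ^ n) (\<lambda>h. f h ^ n)"
  by (induction n) (use power_series_le_const[of \<rho> 1] in \<open>auto intro: power_series_le_mult\<close>)

lemma power_series_le_exp:
  assumes rho: "\<rho> > 0" and f: "power_series_le \<rho> K f"
  shows "power_series_le \<rho> (exp K) (\<lambda>h. exp (f h))"
proof (rule power_series_le_sums[OF rho])
  show "power_series_le \<rho> (\<bar>inverse (fact k)\<bar> * K ^ k) (\<lambda>h. inverse (fact k) * f h ^ k)" for k
    by (rule power_series_le_cmult[OF rho power_series_le_power[OF rho f]])
  show "(\<lambda>k. \<bar>inverse (fact k)\<bar> * K ^ k) sums exp K"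
    using exp_converges[of K] by simp
  show "(\<lambda>k. inverse (fact k) * f h ^ k) sums exp (f h)" for h
    using exp_converges[of "f h"] by simp
qed

text \<open>The constant coefficient vanishes, so the coefficient norm is at most linear in the radius.\<close>

lemma power_series_le_shrink:
  fixes f :: "real^'l::finite \<Rightarrow> real"
  assumes rho: "\<rho> > 0" and f: "power_series_le \<rho> K f" and f0: "f 0 = 0" and r: "0 < \<rho>'" "\<rho>' \<le> \<rho>"
  shows "power_series_le \<rho>' (\<rho>' / \<rho> * K) f"
proof -
  obtain c S where S: "((\<lambda>\<alpha>. \<bar>c \<alpha>\<bar> * \<rho> ^ multi_degree \<alpha>) has_sum S) UNIV" "S \<le> K"
    and c: "\<And>h. h\<in>cube \<rho> \<Longrightarrow> ((\<lambda>\<alpha>. c \<alpha> * monomial_at h \<alpha>) has_sum f h) UNIV"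
    using f unfolding power_series_le_def by blast
  have mono0: "monomial_at (0::real^'l) \<alpha> = (if \<alpha> = (\<lambda>_. 0) then 1 else 0)" for \<alpha>
    by (auto simp: monomial_at_def fun_eq_iff power_0_left)
  have "((\<lambda>\<alpha>. c \<alpha> * monomial_at 0 \<alpha>) has_sum f 0) UNIV"
    using rho by (intro c) (auto simp: cube_def)
  moreover have "((\<lambda>\<alpha>. c \<alpha> * monomial_at 0 \<alpha>) has_sum c (\<lambda>_. 0)) UNIV"
    by (rule has_sum_finite_neutralI[of "{\<lambda>_. 0}"]) (auto simp: mono0)
  ultimately have c0: "c (\<lambda>_. 0) = 0" using f0 has_sum_unique by fastforce
  \<comment> \<open>In positive degree one factor \<open>\<rho>' / \<rho>\<close> can be split off
    and the other powers only decrease; in degree zero the coefficient has just been seen to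
    vanish.\<close>
  have le: "\<bar>c \<alpha>\<bar> * \<rho>' ^ multi_degree \<alpha> \<le> \<rho>' / \<rho> * (\<bar>c \<alpha>\<bar> * \<rho> ^ multi_degree \<alpha>)" for \<alpha>
  proof (cases "multi_degree \<alpha>")
    case 0
    hence "\<alpha> = (\<lambda>_. 0)" by (auto simp: multi_degree_def)
    then show ?thesis using c0 by simp
  next
    case (Suc n)
    have "\<rho>' ^ n \<le> \<rho> ^ n" using r by (intro power_mono) auto
    hence "(\<bar>c \<alpha>\<bar> * \<rho>') * \<rho>' ^ n \<le> (\<bar>c \<alpha>\<bar> * \<rho>') * \<rho> ^ n"
      using r by (intro mult_left_mono) auto
    then show ?thesis using r rho by (simp add: Suc mult_ac)
  qed
  have T: "((\<lambda>\<alpha>. \<rho>' / \<rho> * (\<bar>c \<alpha>\<bar> * \<rho> ^ multi_degree \<alpha>)) has_sum \<rho>' / \<rho> * S) UNIV"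
    by (rule has_sum_cmult_right[OF S(1)])
  have "(\<lambda>\<alpha>. \<bar>c \<alpha>\<bar> * \<rho>' ^ multi_degree \<alpha>) summable_on UNIV"
    by (rule summable_on_comparison_test[OF has_sum_imp_summable[OF T]]) (use le r in auto)
  then obtain S' where S': "((\<lambda>\<alpha>. \<bar>c \<alpha>\<bar> * \<rho>' ^ multi_degree \<alpha>) has_sum S') UNIV"
    using summable_on_def by blast
  have "S' \<le> \<rho>' / \<rho> * S" using has_sum_mono[OF S' T] le by auto
  also have "\<dots> \<le> \<rho>' / \<rho> * K" using S(2) r rho by (intro mult_left_mono) auto
  finally show ?thesis unfolding power_series_le_def using S' c r(2)
    by (intro exI[of _ c] exI[of _ S']) (auto simp: cube_def intro: order_trans)
qed

section \<open>Germs of analytic functions at the origin\<close>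

definition analytic_at_0 :: "(real^'l::finite \<Rightarrow> real) \<Rightarrow> bool" where
  "analytic_at_0 f \<longleftrightarrow> (\<exists>\<rho>>0. \<exists>K. power_series_le \<rho> K f)"

lemma power_series_le_restrict:
  assumes "power_series_le \<rho> K f" "0 < \<rho>'" "\<rho>' \<le> \<rho>"
  shows "power_series_le \<rho>' (\<bar>f 0\<bar> + (K + \<bar>f 0\<bar>) * (\<rho>' / \<rho>)) f"
proof -
  have rho: "\<rho> > 0" using assms by auto
  have "power_series_le \<rho> (K + \<bar>- f 0\<bar>) (\<lambda>h. f h + (- f 0))"
    by (rule power_series_le_add[OF rho assms(1) power_series_le_const[OF rho]])
  hence "power_series_le \<rho>' (\<rho>' / \<rho> * (K + \<bar>- f 0\<bar>)) (\<lambda>h. f h + (- f 0))"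
    by (rule power_series_le_shrink[OF rho]) (use assms in auto)
  from power_series_le_add[OF assms(2) power_series_le_const[OF assms(2), of "f 0"] this] show ?thesis
    by (simp add: mult.commute)
qed

text \<open>The value at 0 has norm \<open>\<bar>f 0\<bar>\<close>, and the remainder vanishes at 0,
  so its norm is linear in the radius. The bound is stated for all small radii, so that finitely
  many functions can be controlled on a common cube.\<close>

lemma analytic_at_0_small:
  assumes "analytic_at_0 f" "\<delta> > 0"
  shows "\<forall>\<^sub>F \<rho> in at_right 0. power_series_le \<rho> (\<bar>f 0\<bar> + \<delta>) f"
proof -
  obtain \<rho> K where r: "\<rho> > 0" "power_series_le \<rho> K f" using assms unfolding analytic_at_0_def by auto
  have K: "K \<ge> 0" using power_series_le_nonneg[OF less_imp_le[OF r(1)] r(2)] .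
  \<comment> \<open>Solves \<open>(K + \<bar>f 0\<bar>) * (x / \<rho>) \<le> \<delta>\<close> for
    the radius \<open>x\<close>; the added 1 keeps the denominator positive.\<close>
  define \<rho>1 where "\<rho>1 = min \<rho> (\<delta> * \<rho> / (K + \<bar>f 0\<bar> + 1))"
  have r1: "\<rho>1 > 0" using r assms K by (auto simp: \<rho>1_def intro!: divide_pos_pos)
  show ?thesis
  proof (rule eventually_at_rightI[OF _ r1])
    fix x assume x: "x \<in> {0<..<\<rho>1}"
    have "x * (K + \<bar>f 0\<bar> + 1) \<le> \<delta> * \<rho>"
      using x K by (auto simp: \<rho>1_def field_simps)
    moreover have "x * (K + \<bar>f 0\<bar>) \<le> x * (K + \<bar>f 0\<bar> + 1)" using x by (intro mult_left_mono) auto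
    ultimately have "(K + \<bar>f 0\<bar>) * (x / \<rho>) \<le> \<delta>" using r by (simp add: field_simps)
    then show "power_series_le x (\<bar>f 0\<bar> + \<delta>) f"
      using power_series_le_mono[OF power_series_le_restrict[OF r(2), of x]] x by (simp add: \<rho>1_def)
  qed
qed

lemma analytic_at_0I: "\<rho> > 0 \<Longrightarrow> power_series_le \<rho> K f \<Longrightarrow> analytic_at_0 f"
  unfolding analytic_at_0_def by blast

lemma analytic_at_0_eventually:
  assumes "analytic_at_0 f" shows "\<exists>K. \<forall>\<^sub>F \<rho> in at_right 0. power_series_le \<rho> K f"
  using analytic_at_0_small[OF assms zero_less_one] by blast

lemma eventually_pos_at_right: "\<forall>\<^sub>F \<rho> in at_right (0::real). \<rho> > 0"
  by (simp add: eventually_at_right_less)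

lemma analytic_at_0_eventuallyI:
  assumes "\<forall>\<^sub>F \<rho> in at_right 0. \<rho> > 0 \<and> power_series_le \<rho> K f" shows "analytic_at_0 f"
  using eventually_happens[OF assms] by (auto intro: analytic_at_0I)

lemma analytic_at_0_const [intro]: "analytic_at_0 (\<lambda>_. k)"
  using analytic_at_0I[OF zero_less_one power_series_le_const[OF zero_less_one]] .

lemma analytic_at_0_coord [intro]: "analytic_at_0 (\<lambda>h. h $ i)"
  using analytic_at_0I[OF zero_less_one power_series_le_coord[OF zero_less_one]] .

lemma analytic_at_0_mult [intro]:
  assumes "analytic_at_0 f" "analytic_at_0 g" shows "analytic_at_0 (\<lambda>h. f h * g h)"
proof -
  obtain K where K: "\<forall>\<^sub>F \<rho> in at_right 0. power_series_le \<rho> K f" using analytic_at_0_eventually[OF assms(1)] ..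
  obtain L where L: "\<forall>\<^sub>F \<rho> in at_right 0. power_series_le \<rho> L g" using analytic_at_0_eventually[OF assms(2)] ..
  from eventually_pos_at_right K L have "\<forall>\<^sub>F \<rho> in at_right 0. \<rho> > 0 \<and> power_series_le \<rho> (K * L) (\<lambda>h. f h * g h)"
    by eventually_elim (auto intro: power_series_le_mult)
  then show ?thesis by (rule analytic_at_0_eventuallyI)
qed

lemma analytic_at_0_add [intro]:
  assumes "analytic_at_0 f" "analytic_at_0 g" shows "analytic_at_0 (\<lambda>h. f h + g h)"
proof -
  obtain K where K: "\<forall>\<^sub>F \<rho> in at_right 0. power_series_le \<rho> K f" using analytic_at_0_eventually[OF assms(1)] ..
  obtain L where L: "\<forall>\<^sub>F \<rho> in at_right 0. power_series_le \<rho> L g" using analytic_at_0_eventually[OF assms(2)] ..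
  from eventually_pos_at_right K L have "\<forall>\<^sub>F \<rho> in at_right 0. \<rho> > 0 \<and> power_series_le \<rho> (K + L) (\<lambda>h. f h + g h)"
    by eventually_elim (auto intro: power_series_le_add)
  then show ?thesis by (rule analytic_at_0_eventuallyI)
qed

lemma analytic_at_0_sum [intro]:
  assumes "\<And>i. i \<in> I \<Longrightarrow> analytic_at_0 (f i)" shows "analytic_at_0 (\<lambda>h. \<Sum>i\<in>I. f i h)"
  using assms by (induction I rule: infinite_finite_induct) auto

lemma analytic_at_0_diff [intro]:
  assumes "analytic_at_0 f" "analytic_at_0 g" shows "analytic_at_0 (\<lambda>h. f h - g h)"
  using analytic_at_0_add[OF assms(1) analytic_at_0_mult[OF analytic_at_0_const[of "-1"] assms(2)]] by simp

lemma analytic_at_0_exp [intro]: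
  assumes "analytic_at_0 f" shows "analytic_at_0 (\<lambda>h. exp (f h))"
  using assms power_series_le_exp unfolding analytic_at_0_def by blast

lemma analytic_at_0_cong:
  assumes "analytic_at_0 f" "\<rho> > 0" "\<And>h. h \<in> cube \<rho> \<Longrightarrow> f h = g h"
  shows "analytic_at_0 g"
proof -
  obtain K where "\<forall>\<^sub>F \<rho> in at_right 0. power_series_le \<rho> K f" using analytic_at_0_eventually[OF assms(1)] ..
  moreover have "\<forall>\<^sub>F x in at_right 0. x < \<rho>" using assms(2) eventually_at_right by blast
  ultimately have "\<forall>\<^sub>F x in at_right 0. x > 0 \<and> power_series_le x K g" using eventually_pos_at_right
  proof eventually_elim
    case (elim x)
    then have "cube x \<subseteq> (cube \<rho> :: (real^'a) set)" by (auto simp: cube_def intro: order_trans less_imp_le)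
    with elim assms(3) show ?case by (auto intro: power_series_le_cong)
  qed
  then show ?thesis by (rule analytic_at_0_eventuallyI)
qed

lemma analytic_at_0_close:
  assumes "analytic_at_0 f" "\<delta> > 0"
  shows "\<forall>\<^sub>F \<rho> in at_right 0. \<forall>h\<in>cube \<rho>. \<bar>f h - f 0\<bar> \<le> \<delta>"
proof -
  have "analytic_at_0 (\<lambda>h. f h - f 0)" by (rule analytic_at_0_diff[OF assms(1) analytic_at_0_const])
  from analytic_at_0_small[OF this assms(2)] show ?thesis
    by eventually_elim (auto dest: power_series_le_bound)
qed

lemma analytic_at_0_inverse:
  assumes f: "analytic_at_0 f" and f0: "f 0 \<noteq> 0" shows "analytic_at_0 (\<lambda>h. inverse (f h))"
proof -
  \<comment> \<open>The inverse of \<open>f\<close> is \<open>inverse (f 0)\<close> times the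
    geometric series in \<open>g\<close>. As \<open>g\<close> vanishes at the origin, a small radius
    brings its norm to 1/2 and that of the series to at most 2.\<close>
  define g where "g h = 1 - f h * inverse (f 0)" for h
  have "analytic_at_0 g" unfolding g_def by (rule analytic_at_0_diff[OF analytic_at_0_const analytic_at_0_mult[OF f analytic_at_0_const]])
  moreover have "g 0 = 0" using f0 by (simp add: g_def)
  ultimately have "\<forall>\<^sub>F \<rho> in at_right 0. power_series_le \<rho> (1/2) g" using analytic_at_0_small[of g "1/2"] by simp
  then have "\<forall>\<^sub>F \<rho> in at_right 0. \<rho> > 0 \<and> power_series_le \<rho> (1/2) g"
    using eventually_pos_at_right by eventually_elim auto
  then obtain \<rho> where rho: "\<rho> > 0" and g: "power_series_le \<rho> (1/2) g"
    by (auto dest: eventually_happens)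
  have "power_series_le \<rho> 2 (\<lambda>h. inverse (1 - g h))"
  proof (rule power_series_le_sums[OF rho power_series_le_power[OF rho g]])
    show "(\<lambda>k. (1/2) ^ k) sums (2::real)" using geometric_sums[of "1/2::real"] by simp
    show "(\<lambda>k. g h ^ k) sums inverse (1 - g h)" if "h \<in> cube \<rho>" for h
      using power_series_le_bound[OF g that] by (auto intro!: geometric_sums simp: inverse_eq_divide)
  qed
  hence "analytic_at_0 (\<lambda>h. inverse (f 0) * inverse (1 - g h))" by (rule analytic_at_0_mult[OF analytic_at_0_const analytic_at_0I[OF rho]])
  moreover have "inverse (f 0) * inverse (1 - g h) = inverse (f h)" for h
    using f0 by (simp add: g_def)
  ultimately show ?thesis by simp
qed

lemma analytic_at_0_real_analytic:
  assumes "\<And>x. analytic_at_0 (\<lambda>h. f (x + h))"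
  shows "real_analytic f"
  unfolding real_analytic_def
proof
  fix x
  from assms[of x] obtain \<rho> K where rho: "\<rho> > 0" and "power_series_le \<rho> K (\<lambda>h. f (x + h))"
    unfolding analytic_at_0_def by (elim exE conjE)
  then obtain c where c: "\<And>h. h \<in> cube \<rho> \<Longrightarrow> ((\<lambda>\<alpha>. c \<alpha> * monomial_at h \<alpha>) has_sum f (x + h)) UNIV"
    unfolding power_series_le_def by (elim exE conjE) (rule that, erule bspec)
  show "\<exists>c. \<exists>\<rho>>0. \<forall>h. (\<forall>i. \<bar>h $ i\<bar> < \<rho>) \<longrightarrow>
      ((\<lambda>\<alpha>. c \<alpha> * (\<Prod>i\<in>UNIV. (h $ i) ^ \<alpha> i)) has_sum f (x + h)) UNIV"
    using rho c unfolding cube_def monomial_at_def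
    by (intro exI[of _ c] exI[of _ \<rho>]) (auto intro: less_imp_le)
qed

section \<open>Perron-Frobenius theory of primitive matrices\<close>

lemma matrix_power_add: "matrix_power T (a + b) = matrix_power T a ** matrix_power T b"
  by (induction a) (simp_all add: matrix_mul_assoc)

lemma matrix_power_mult: "matrix_power T (a * b) = matrix_power (matrix_power T a) b"
proof (induction b)
  case (Suc b)
  have "matrix_power T (a * Suc b) = matrix_power T (a + a * b)" by simp
  then show ?case using Suc by (simp add: matrix_power_add)
qed simp

lemma matrix_power_transpose: "matrix_power (transpose T) n = transpose (matrix_power T n)"
proof (induction n)
  case (Suc n)
  have "matrix_power T (Suc n) = matrix_power T n ** T"
    using matrix_power_add[of T n 1] by simp
  then show ?case using Suc by (simp add: matrix_transpose_mul del: matrix_power.simps(2))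
     (simp add: matrix_transpose_mul)
qed simp

lemma matrix_power_eigenvector:
  assumes "T *v x = y *\<^sub>R x" shows "matrix_power T n *v x = y ^ n *\<^sub>R x"
proof (induction n)
  case (Suc n)
  then show ?case
    by (simp add: matrix_vector_mul_assoc[symmetric] matrix_vector_mult_scaleR assms)
qed simp

lemma matrix_power_nonneg:
  assumes "0 \<le> T" shows "0 \<le> matrix_power T n $ i $ j"
proof (induction n arbitrary: i j)
  case 0 then show ?case by (simp add: mat_def)
next
  case (Suc n)
  then show ?case using assms
    by (auto simp: matrix_matrix_mult_def less_eq_vec_def intro!: sum_nonneg)
qed

lemma transpose_nonneg: "0 \<le> T \<Longrightarrow> 0 \<le> transpose (T :: real^'m^'m)"
  by (auto simp: less_eq_vec_def transpose_def)

lemma primitive_transpose: "primitive_matrix T \<Longrightarrow> primitive_matrix (transpose T)"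
  unfolding primitive_matrix_def matrix_power_transpose
  by (auto simp: transpose_nonneg) (auto simp: transpose_def)

lemma inner_matrix_transpose: "u \<bullet> (T *v x) = (transpose T *v u) \<bullet> (x :: real^'m)"
  by (simp add: dot_lmul_matrix)

lemma positive_matrix_vector_pos:
  fixes P :: "real^'m^'m"
  assumes "\<And>i j. P $ i $ j > 0" and "\<And>i. x $ i \<ge> 0" and "x \<noteq> 0"
  shows "(P *v x) $ i > 0"
proof -
  obtain j where j: "x $ j \<noteq> 0" using assms(3) by (auto simp: vec_eq_iff)
  then have "0 < P $ i $ j * x $ j" using assms(1)[of i j] assms(2)[of j] by simp
  then show ?thesis unfolding matrix_vector_mult_def using assms
    by (auto intro!: sum_pos2[of _ j] simp: less_imp_le)
qed

text \<open>The Brouwer fixed point theorem on the standard simplex yields the eigenvector.\<close>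

lemma primitive_eigenvector:
  fixes T :: "real^'m^'m"
  assumes "primitive_matrix T"
  shows "\<exists>y v. y > 0 \<and> (\<forall>i. v $ i > 0) \<and> T *v v = y *\<^sub>R v"
proof -
  obtain k where k: "k \<ge> 1" "\<And>i j. matrix_power T k $ i $ j > 0" and T0: "0 \<le> T"
    using assms unfolding primitive_matrix_def by auto
  define s where "s x = (\<Sum>i\<in>UNIV. x $ i)" for x :: "real^'m"
  define S where "S = {x :: real^'m. (\<forall>i. 0 \<le> x $ i) \<and> s x = 1}"
  have Tnn: "0 \<le> (T *v x) $ i" if "x \<in> S" for x i
    using T0 that by (auto simp: S_def matrix_vector_mult_def less_eq_vec_def intro!: sum_nonneg)
  \<comment> \<open>Rescaling to the simplex needs \<open>T *v x\<close> to be nonzero: otherwise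
    the positive power of \<open>T\<close> would also annihilate \<open>x\<close>, whereas it makes
    every component positive.\<close>
  have sT: "s (T *v x) > 0" if x: "x \<in> S" for x
  proof (rule ccontr)
    assume "\<not> ?thesis"
    moreover have "s (T *v x) \<ge> 0" unfolding s_def using Tnn[OF x] by (auto intro: sum_nonneg)
    ultimately have "(\<Sum>i\<in>UNIV. (T *v x) $ i) = 0" by (simp add: s_def)
    then have "T *v x = 0" using Tnn[OF x] by (subst (asm) sum_nonneg_eq_0_iff) (auto simp: vec_eq_iff)
    moreover obtain k' where "k = k' + 1" using k(1) by (metis add.commute le_Suc_ex)
    ultimately have "matrix_power T k *v x = 0"
      using matrix_power_add[of T k' 1] by (simp add: matrix_vector_mul_assoc[symmetric])
    moreover have "x \<noteq> 0" using x by (auto simp: S_def s_def)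
    ultimately show False
      using positive_matrix_vector_pos[OF k(2), of x undefined] x by (simp add: S_def)
  qed
  have cs: "continuous_on A s" for A unfolding s_def by (intro continuous_intros)
  have "closed S"
  proof -
    have "S = (\<Inter>i. {x. 0 \<le> x $ i}) \<inter> {x. s x = 1}" by (auto simp: S_def)
    then show ?thesis using cs
      by (auto intro!: closed_Int closed_INT closed_Collect_le closed_Collect_eq continuous_intros)
  qed
  moreover have "bounded S"
  proof (rule boundedI)
    fix x assume x: "x \<in> S"
    have "norm x \<le> (\<Sum>i\<in>UNIV. \<bar>x $ i\<bar>)" by (rule norm_le_l1_cart)
    also have "\<dots> = 1" using x by (simp add: S_def s_def)
    finally show "norm x \<le> 1" .
  qed
  ultimately have "compact S" by (simp add: compact_eq_bounded_closed)
  moreover have "convex S"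
    unfolding convex_def by (auto simp: S_def s_def sum.distrib sum_distrib_left[symmetric])
  moreover have "(\<chi> i. 1 / real CARD('m)) \<in> S" by (simp add: S_def s_def)
  moreover have "continuous_on S (\<lambda>x. (1 / s (T *v x)) *\<^sub>R (T *v x))"
    using sT unfolding s_def
    by (intro continuous_intros linear_continuous_on bounded_linear.continuous_on[OF bounded_linear_vec_nth]) fastforce+
  moreover have "(\<lambda>x. (1 / s (T *v x)) *\<^sub>R (T *v x)) \<in> S \<rightarrow> S"
  proof
    fix x assume x: "x \<in> S"
    show "(1 / s (T *v x)) *\<^sub>R (T *v x) \<in> S"
      using Tnn[OF x] sT[OF x] by (auto simp: S_def s_def sum_divide_distrib[symmetric])
  qed
  ultimately obtain v where v: "v \<in> S" "(1 / s (T *v v)) *\<^sub>R (T *v v) = v"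
    using brouwer[of S "\<lambda>x. (1 / s (T *v x)) *\<^sub>R (T *v x)"] by blast
  define y where "y = s (T *v v)"
  have y: "y > 0" using sT v by (simp add: y_def)
  have "y *\<^sub>R v = y *\<^sub>R ((1 / y) *\<^sub>R (T *v v))" using v(2) by (simp add: y_def)
  then have ev: "T *v v = y *\<^sub>R v" using y by simp
  have "v \<noteq> 0" using v by (auto simp: S_def s_def)
  \<comment> \<open>The fixed point is so far only nonnegative. Applying the positive power of
    \<open>T\<close>, which merely rescales \<open>v\<close>, makes it strictly positive.\<close>
  then have "v $ i > 0" for i
    using positive_matrix_vector_pos[OF k(2), of v i] v y
    by (simp add: S_def matrix_power_eigenvector[OF ev] zero_less_mult_iff)
  with y ev show ?thesis by blast
qed

text \<open>Both vectors belong to the same eigenvalue and carry no normalisation: they are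
  determined only up to scale, and so is the choice made later for each t.\<close>

definition perron_triple :: "real^'m^'m \<Rightarrow> real \<Rightarrow> real^'m \<Rightarrow> real^'m \<Rightarrow> bool" where
  "perron_triple T y v u \<longleftrightarrow> primitive_matrix T \<and> y > 0 \<and> (\<forall>i. v $ i > 0) \<and> (\<forall>i. u $ i > 0) \<and>
     T *v v = y *\<^sub>R v \<and> transpose T *v u = y *\<^sub>R u"

lemma inner_pos:
  fixes u v :: "real^'m"
  assumes "\<And>i. u $ i > 0" "\<And>i. v $ i > 0" shows "u \<bullet> v > 0"
  unfolding inner_vec_def using assms by (auto intro!: sum_pos)

lemma inner_pos_nonneg:
  fixes u x :: "real^'m"
  assumes "\<And>i. u $ i > 0" "0 \<le> x" "x \<noteq> 0" shows "u \<bullet> x > 0"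
proof -
  have x: "x $ i \<ge> 0" for i using assms(2) by (simp add: less_eq_vec_def)
  obtain j where "x $ j \<noteq> 0" using assms(3) by (auto simp: vec_eq_iff)
  then have "0 < u $ j * x $ j" using assms(1)[of j] x[of j] by simp
  then show ?thesis unfolding inner_vec_def using assms(1) x
    by (auto intro!: sum_pos2[of _ j] simp: less_imp_le)
qed

lemma perron_triple_exists:
  assumes "primitive_matrix T" shows "\<exists>y v u. perron_triple T y v u"
proof -
  obtain y v where v: "y > 0" "\<forall>i. v $ i > 0" "T *v v = y *\<^sub>R v"
    using primitive_eigenvector[OF assms] by blast
  obtain y' u where u: "y' > 0" "\<forall>i. u $ i > 0" "transpose T *v u = y' *\<^sub>R u"
    using primitive_eigenvector[OF primitive_transpose[OF assms]] by blast
  \<comment> \<open>The pairing of the left with the right eigenvector is multiplied by either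
    eigenvalue, and it is nonzero because both vectors are positive.\<close>
  have "y * (u \<bullet> v) = u \<bullet> (T *v v)" using v by simp
  also have "\<dots> = y' * (u \<bullet> v)" by (simp only: inner_matrix_transpose u inner_scaleR_left)
  finally have "y = y'" using inner_pos[of u v] u v by simp
  then show ?thesis using u v assms unfolding perron_triple_def by blast
qed

lemma perron_triple_transpose: "perron_triple T y v u \<Longrightarrow> perron_triple (transpose T) y u v"
  by (simp add: perron_triple_def primitive_transpose)

text \<open>For \<open>u \<bullet> x = 0\<close> this is the invariance of the hyperplane orthogonal
  to \<open>u\<close> under all powers of \<open>T\<close>.\<close>

lemma inner_matrix_power:
  assumes "perron_triple T y v u"
  shows "u \<bullet> (matrix_power T n *v x) = y ^ n * (u \<bullet> x)"
proof -
  have "transpose (matrix_power T n) *v u = y ^ n *\<^sub>R u"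
    using assms matrix_power_eigenvector[of "transpose T" u y n]
    by (simp add: perron_triple_def matrix_power_transpose)
  then show ?thesis by (simp only: inner_matrix_transpose inner_scaleR_left)
qed

text \<open>In the sup norm with weights \<open>v $ i\<close>, a nonnegative matrix with eigenvector
  \<open>v\<close> has operator norm at most its eigenvalue, since absolute values can be moved
  inside the matrix product.\<close>

lemma nonneg_matrix_bound:
  fixes R :: "real^'m^'m"
  assumes "\<And>i j. R $ i $ j \<ge> 0" "R *v v = c *\<^sub>R v" "\<And>i. \<bar>x $ i\<bar> \<le> a * v $ i"
  shows "\<bar>(R *v x) $ i\<bar> \<le> a * c * v $ i"
proof -
  have "\<bar>(R *v x) $ i\<bar> \<le> (\<Sum>j\<in>UNIV. \<bar>R $ i $ j * x $ j\<bar>)"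
    unfolding matrix_vector_mult_def by (simp add: sum_abs)
  also have "\<dots> \<le> (\<Sum>j\<in>UNIV. R $ i $ j * (a * v $ j))"
    using assms by (intro sum_mono) (auto simp: abs_mult intro!: mult_left_mono)
  also have "\<dots> = a * (R *v v) $ i"
    by (simp add: matrix_vector_mult_def sum_distrib_left mult_ac)
  finally show ?thesis by (simp add: assms(2))
qed

text \<open>A positive power \<open>P\<close> of \<open>T\<close> dominates a multiple of the rank one matrix \<open>v u'\<close>, which
  vanishes on the hyperplane \<open>u\<^sup>\<bottom>\<close>; what remains of \<open>P\<close> is nonnegative with a smaller eigenvalue at \<open>v\<close>.\<close>

lemma perron_contraction:
  fixes T :: "real^'m^'m"
  assumes "perron_triple T y v u"
  shows "\<exists>\<epsilon> C. 0 < \<epsilon> \<and> \<epsilon> < 1 \<and>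
    (\<forall>x n i. u \<bullet> x = 0 \<longrightarrow> \<bar>(matrix_power T n *v x) $ i\<bar> \<le> C * norm x * (y * \<epsilon>) ^ n)"
proof -
  note pt = assms[unfolded perron_triple_def]
  obtain k where k: "k \<ge> 1" "\<And>i j. matrix_power T k $ i $ j > 0" and T0: "0 \<le> T"
    using pt unfolding primitive_matrix_def by auto
  have y: "y > 0" and v: "\<And>i. v $ i > 0" and u: "\<And>i. u $ i > 0" using pt by auto
  define P where "P = matrix_power T k"
  have P: "P $ i $ j > 0" for i j using k(2) by (simp add: P_def)
  have Pv: "P *v v = y ^ k *\<^sub>R v" using pt by (simp add: P_def matrix_power_eigenvector)
  define d where "d = u \<bullet> v"
  have d: "d > 0" using inner_pos u v by (auto simp: d_def)
  define F where "F = (\<lambda>(i, j). P $ i $ j / (y ^ k * v $ i * u $ j)) ` UNIV"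
  have F: "finite F" "F \<noteq> {}" by (auto simp: F_def)
  have F0: "f > 0" if "f \<in> F" for f using that P y v u by (auto simp: F_def)
  \<comment> \<open>\<open>Min F\<close> is the largest multiple of the rank one matrix
    \<open>y ^ k * v $ i * u $ j\<close> that stays entrywise below \<open>P\<close>. The cap
    \<open>1 / (2 * d)\<close> keeps \<open>q = 1 - \<delta> * d\<close> positive, so that it can be
    divided by and its root taken.\<close>
  define \<delta> where "\<delta> = min (Min F) (1 / (2 * d))"
  have \<delta>: "\<delta> > 0" "\<delta> * d < 1" using F0 F d by (auto simp: \<delta>_def min_def field_simps)
  have \<delta>P: "\<delta> * (y ^ k * v $ i * u $ j) \<le> P $ i $ j" for i j
  proof -
    have "Min F \<le> P $ i $ j / (y ^ k * v $ i * u $ j)"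
      by (rule Min_le[OF F(1)]) (auto simp: F_def)
    then have "\<delta> \<le> P $ i $ j / (y ^ k * v $ i * u $ j)" by (simp add: \<delta>_def)
    then show ?thesis using y v[of i] u[of j] by (simp add: field_simps)
  qed
  define q where "q = 1 - \<delta> * d"
  have q: "0 < q" "q < 1" using \<delta> d by (auto simp: q_def)
  \<comment> \<open>\<open>P\<close> and \<open>R\<close> agree on the hyperplane orthogonal to
    \<open>u\<close>, but \<open>R\<close> has eigenvalue \<open>y ^ k * q\<close> at
    \<open>v\<close> instead of \<open>y ^ k\<close>; in the weighted sup norm this is the
    contraction.\<close>
  define R where "R = (\<chi> i j. P $ i $ j - \<delta> * (y ^ k * v $ i * u $ j))"
  have R: "R $ i $ j \<ge> 0" for i j using \<delta>P by (simp add: R_def)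
  have Rx: "R *v x = P *v x - (\<delta> * y ^ k * (u \<bullet> x)) *\<^sub>R v" for x
    by (simp add: vec_eq_iff R_def matrix_vector_mult_def inner_vec_def left_diff_distrib
        right_diff_distrib sum_subtractf sum_distrib_left sum_distrib_right mult_ac)
  have Rv: "R *v v = (y ^ k * q) *\<^sub>R v"
    by (simp add: Rx Pv q_def d_def algebra_simps)
  have stepP: "\<bar>(matrix_power T (k * n) *v x) $ i\<bar> \<le> a * (y ^ k * q) ^ n * v $ i"
    if x: "u \<bullet> x = 0" and a: "\<And>i. \<bar>x $ i\<bar> \<le> a * v $ i" for n x a i
  proof (induction n arbitrary: i)
    case 0 then show ?case using a by simp
  next
    case (Suc n)
    have "matrix_power T (k * Suc n) *v x = P *v (matrix_power T (k * n) *v x)"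
      by (simp add: P_def matrix_power_add matrix_vector_mul_assoc)
    also have "\<dots> = R *v (matrix_power T (k * n) *v x)"
      by (simp add: Rx inner_matrix_power[OF assms] x)
    finally show ?case
      using nonneg_matrix_bound[OF R Rv Suc, of i] by (simp add: mult_ac)
  qed
  have stepT: "\<bar>(matrix_power T n *v x) $ i\<bar> \<le> a * y ^ n * v $ i"
    if a: "\<And>i. \<bar>x $ i\<bar> \<le> a * v $ i" for n x a i
    by (rule nonneg_matrix_bound[OF matrix_power_nonneg[OF T0] _ a])
       (use pt in \<open>simp add: matrix_power_eigenvector\<close>)
  \<comment> \<open>A gain of \<open>q\<close> per block of \<open>k\<close> steps is spread evenly
    over the single steps.\<close>
  define \<epsilon> where "\<epsilon> = root k q"
  have \<epsilon>: "0 < \<epsilon>" "\<epsilon> < 1" "\<epsilon> ^ k = q" using k(1) q by (auto simp: \<epsilon>_def)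
  define b where "b = Min (range (\<lambda>i. v $ i))"
  have b: "b > 0" "\<And>i. b \<le> v $ i" using v by (auto simp: b_def)
  have main: "\<bar>(matrix_power T n *v x) $ i\<bar> \<le> norm v / (q * b) * norm x * (y * \<epsilon>) ^ n"
    if x: "u \<bullet> x = 0" for x n i
  proof -
    \<comment> \<open>Converts the Euclidean norm into the weighted sup norm: every weight is at
      least \<open>b\<close>.\<close>
    define a where "a = norm x / b"
    have a0: "a \<ge> 0" using b by (simp add: a_def)
    have a: "\<bar>x $ i\<bar> \<le> a * v $ i" for i
    proof -
      have "\<bar>x $ i\<bar> \<le> a * b" using b component_le_norm_cart[of x i] by (simp add: a_def)
      also have "\<dots> \<le> a * v $ i" using b a0 by (intro mult_left_mono) auto
      finally show ?thesis .
    qed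
    \<comment> \<open>Only complete blocks of \<open>k\<close> steps gain the factor
      \<open>q\<close>; the remaining \<open>l\<close> steps are bounded by \<open>y ^ l\<close>.
      The incomplete block costs at most the factor \<open>1 / q\<close>.\<close>
    define m where "m = n div k"
    define l where "l = n mod k"
    have n: "n = l + k * m" by (simp add: m_def l_def)
    have l: "l \<le> k" using k(1) by (simp add: l_def less_imp_le)
    have qm: "q ^ m \<le> \<epsilon> ^ n / q"
    proof -
      have "\<epsilon> ^ k * \<epsilon> ^ (k * m) \<le> \<epsilon> ^ l * \<epsilon> ^ (k * m)"
        using \<epsilon> l by (intro mult_right_mono power_decreasing) auto
      also have "\<dots> = \<epsilon> ^ n" by (simp add: n power_add)
      finally show ?thesis using q by (simp add: \<epsilon> power_mult field_simps)
    qed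
    have "matrix_power T n *v x = matrix_power T l *v (matrix_power T (k * m) *v x)"
      unfolding n by (simp add: matrix_power_add matrix_vector_mul_assoc)
    then have "\<bar>(matrix_power T n *v x) $ i\<bar> \<le> a * (y ^ k * q) ^ m * y ^ l * v $ i"
      using stepT[OF stepP[OF x a], of l] by simp
    also have "\<dots> = a * y ^ n * q ^ m * v $ i"
      by (simp add: n power_add power_mult power_mult_distrib)
    also have "\<dots> \<le> a * y ^ n * (\<epsilon> ^ n / q) * norm v"
      using qm a0 y v[of i] q \<epsilon> component_le_norm_cart[of v i]
      by (intro mult_mono mult_left_mono) auto
    also have "\<dots> = norm v / (q * b) * norm x * (y * \<epsilon>) ^ n"
      by (simp add: a_def power_mult_distrib mult_ac)
    finally show ?thesis .
  qed
  then show ?thesis using \<epsilon> by blast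
qed

text \<open>If \<open>a > c\<close>, the powers of \<open>a / c\<close> would exceed
  \<open>D / b\<close>. This turns the decay estimate on iterates into an inequality between
  eigenvalues.\<close>

lemma power_growth_le:
  fixes a b c :: real
  assumes le: "\<And>n. a ^ n * b \<le> D * c ^ n" and "b > 0" "c > 0" "a \<ge> 0"
  shows "a \<le> c"
proof (rule ccontr)
  assume "\<not> a \<le> c"
  then have "1 < a / c" using assms by simp
  then obtain n where "D / b < (a / c) ^ n" using real_arch_pow by blast
  then have "D * c ^ n < a ^ n * b" using assms by (simp add: field_simps)
  with le[of n] show False by simp
qed

section \<open>Spectral characterisation of the Perron-Frobenius eigenvalue\<close>

lemma complex_eigenvalue_iff:
  "complex_eigenvalue T z \<longleftrightarrow>
     (\<exists>w. w \<noteq> 0 \<and> (\<forall>i. (\<Sum>j\<in>UNIV. complex_of_real (T $ i $ j) * w $ j) = z * w $ i))"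
  unfolding complex_eigenvalue_def vec_eq_iff[of "_ *v _"]
  by (simp add: matrix_vector_mult_def map_matrix_def)

text \<open>Pairing \<open>u\<close> with an eigenvector \<open>w\<close> for \<open>z\<close> gives
  \<open>z * s = y * s\<close>, hence \<open>s = 0\<close>. So the real and imaginary parts of
  \<open>w\<close> are orthogonal to \<open>u\<close>, and their iterates decay at rate
  \<open>y * \<epsilon>\<close>; since the iterates of \<open>w\<close> grow like
  \<open>cmod z ^ n\<close>, it follows that \<open>cmod z \<le> y * \<epsilon>\<close>.\<close>

lemma perron_eigenvalue_dominates:
  fixes T :: "real^'m^'m"
  assumes pt: "perron_triple T y v u" and z: "complex_eigenvalue T z" "z \<noteq> complex_of_real y"
  shows "cmod z < y"
proof -
  obtain w where w0: "w \<noteq> 0" and w: "\<And>i. (\<Sum>j\<in>UNIV. complex_of_real (T $ i $ j) * w $ j) = z * w $ i"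
    using z(1) unfolding complex_eigenvalue_iff by blast
  obtain \<epsilon> C where \<epsilon>: "0 < \<epsilon>" "\<epsilon> < 1"
    and C: "\<And>x n i. u \<bullet> x = 0 \<Longrightarrow> \<bar>(matrix_power T n *v x) $ i\<bar> \<le> C * norm x * (y * \<epsilon>) ^ n"
    using perron_contraction[OF pt] by blast
  have y: "y > 0" using pt by (simp add: perron_triple_def)
  have uT: "(\<Sum>i\<in>UNIV. u $ i * T $ i $ j) = y * u $ j" for j
  proof -
    have "(transpose T *v u) $ j = y * u $ j" using pt by (simp add: perron_triple_def)
    then show ?thesis by (simp add: matrix_vector_mult_def transpose_def mult.commute del: transpose_matrix_vector)
  qed
  define s where "s = (\<Sum>i\<in>UNIV. complex_of_real (u $ i) * w $ i)"
  have "z * s = (\<Sum>i\<in>UNIV. complex_of_real (u $ i) * (z * w $ i))"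
    by (simp add: s_def sum_distrib_left mult_ac)
  also have "\<dots> = (\<Sum>i\<in>UNIV. \<Sum>j\<in>UNIV. complex_of_real (u $ i) * (complex_of_real (T $ i $ j) * w $ j))"
    by (simp add: w[symmetric] sum_distrib_left)
  also have "\<dots> = (\<Sum>j\<in>UNIV. complex_of_real (\<Sum>i\<in>UNIV. u $ i * T $ i $ j) * w $ j)"
    by (subst sum.swap) (simp add: sum_distrib_left sum_distrib_right mult_ac)
  also have "\<dots> = complex_of_real y * s"
    by (simp add: uT s_def sum_distrib_left mult_ac)
  finally have s: "s = 0" using z(2) by simp
  define p where "p = (\<chi> i. Re (w $ i))"
  define r where "r = (\<chi> i. Im (w $ i))"
  have pr: "u \<bullet> p = 0" "u \<bullet> r = 0"
    using arg_cong[OF s, of Re] arg_cong[OF s, of Im]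
    by (simp_all add: p_def r_def inner_vec_def s_def)
  \<comment> \<open>As \<open>T\<close> is real, its powers act separately on the real and imaginary
    parts of \<open>w\<close>.\<close>
  have pow: "(matrix_power T n *v p) $ i = Re (z ^ n * w $ i)"
    "(matrix_power T n *v r) $ i = Im (z ^ n * w $ i)" for n i
  proof (induction n arbitrary: i)
    case (Suc n)
    have eq: "z ^ Suc n * w $ i = (\<Sum>j\<in>UNIV. complex_of_real (T $ i $ j) * (z ^ n * w $ j))" for i
    proof -
      have "z ^ Suc n * w $ i = z ^ n * (z * w $ i)" by simp
      also have "\<dots> = (\<Sum>j\<in>UNIV. complex_of_real (T $ i $ j) * (z ^ n * w $ j))"
        unfolding w[symmetric] sum_distrib_left by (simp add: mult_ac)
      finally show ?thesis .
    qed
    have *: "matrix_power T (Suc n) *v x = T *v (matrix_power T n *v x)" for x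
      by (simp add: matrix_vector_mul_assoc)
    have re: "Re (complex_of_real a * c) = a * Re c" "Im (complex_of_real a * c) = a * Im c" for a c
      by simp_all
    { case 1 show ?case by (simp only: * matrix_vector_mult_def[of T] vec_lambda_beta eq Re_sum re Suc) }
    { case 2 show ?case by (simp only: * matrix_vector_mult_def[of T] vec_lambda_beta eq Im_sum re Suc) }
  qed (simp_all add: p_def r_def)
  obtain i where i: "w $ i \<noteq> 0" using w0 by (auto simp: vec_eq_iff)
  have le: "cmod z ^ n * cmod (w $ i) \<le> (C * norm p + C * norm r) * (y * \<epsilon>) ^ n" for n
  proof -
    have "cmod z ^ n * cmod (w $ i) = cmod (z ^ n * w $ i)" by (simp add: norm_mult norm_power)
    also have "\<dots> \<le> \<bar>Re (z ^ n * w $ i)\<bar> + \<bar>Im (z ^ n * w $ i)\<bar>" by (rule cmod_le)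
    also have "\<dots> \<le> C * norm p * (y * \<epsilon>) ^ n + C * norm r * (y * \<epsilon>) ^ n"
      unfolding pow[symmetric] by (intro add_mono C pr)
    finally show ?thesis by (simp add: distrib_right)
  qed
  have "cmod z \<le> y * \<epsilon>"
    by (rule power_growth_le[OF le]) (use i y \<epsilon> in auto)
  also have "\<dots> < y" using y \<epsilon> by simp
  finally show ?thesis .
qed

lemma perron_frobenius_eigenvalue_eq:
  assumes pt: "perron_triple T y v u"
  shows "perron_frobenius_eigenvalue T = y"
  unfolding perron_frobenius_eigenvalue_def
proof (rule the_equality)
  have y: "y > 0" using pt by (simp add: perron_triple_def)
  have Tv: "(\<Sum>j\<in>UNIV. T $ i $ j * v $ j) = y * v $ i" for i
  proof -
    have "(T *v v) $ i = y * v $ i" using pt by (simp add: perron_triple_def)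
    then show ?thesis by (simp add: matrix_vector_mult_def)
  qed
  have "complex_eigenvalue T (complex_of_real y)"
    unfolding complex_eigenvalue_iff
  proof (intro exI[of _ "\<chi> i. complex_of_real (v $ i)"] conjI allI)
    show "(\<chi> i. complex_of_real (v $ i)) \<noteq> 0"
      using pt by (simp add: perron_triple_def vec_eq_iff less_imp_neq[symmetric])
    show "(\<Sum>j\<in>UNIV. complex_of_real (T $ i $ j) * (\<chi> i. complex_of_real (v $ i)) $ j) =
         complex_of_real y * (\<chi> i. complex_of_real (v $ i)) $ i" for i
      using arg_cong[OF Tv[of i], of complex_of_real] by simp
  qed
  then show *: "complex_eigenvalue T (complex_of_real y) \<and>
      (\<forall>z. complex_eigenvalue T z \<and> z \<noteq> complex_of_real y \<longrightarrow> cmod z < cmod (complex_of_real y))"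
    using perron_eigenvalue_dominates[OF pt] y by auto
  fix x assume x: "complex_eigenvalue T (complex_of_real x) \<and>
      (\<forall>z. complex_eigenvalue T z \<and> z \<noteq> complex_of_real x \<longrightarrow> cmod z < cmod (complex_of_real x))"
  show "x = y"
  \<comment> \<open>Two distinct eigenvalues that are both strictly dominant would each exceed the
    other in modulus.\<close>
  proof (rule ccontr)
    assume "x \<noteq> y"
    then have "complex_of_real x \<noteq> complex_of_real y" by simp
    with x * have "cmod (complex_of_real y) < cmod (complex_of_real x)"
      "cmod (complex_of_real x) < cmod (complex_of_real y)" by metis+
    then show False by simp
  qed
qed

section \<open>Asymptotics of powers and uniqueness of the eigenvector\<close>

lemma perron_decomposition:
  assumes pt: "perron_triple T y v u"
  shows "u \<bullet> (x - ((u \<bullet> x) / (u \<bullet> v)) *\<^sub>R v) = 0"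
  using inner_pos[of u v] pt by (simp add: perron_triple_def inner_diff_right)

text \<open>Split \<open>\<eta>\<close> by the projection along \<open>v\<close> onto the hyperplane
  orthogonal to \<open>u\<close>. The multiple of \<open>v\<close> contributes an exact multiple of
  \<open>y ^ n\<close>, and the other part decays relative to \<open>y ^ n\<close>; it becomes
  \<open>e n\<close> after division.\<close>

lemma perron_asymptotics:
  fixes T :: "real^'m^'m"
  assumes pt: "perron_triple T y v u"
  shows "\<exists>\<epsilon> D e. 0 < \<epsilon> \<and> \<epsilon> < 1 \<and> (\<forall>n. \<bar>e n\<bar> \<le> D * \<epsilon> ^ n \<and>
     \<xi> \<bullet> (matrix_power T n *v \<eta>) = y ^ n * ((\<xi> \<bullet> v) * (u \<bullet> \<eta>) / (u \<bullet> v) + e n))"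
proof -
  obtain \<epsilon> C where \<epsilon>: "0 < \<epsilon>" "\<epsilon> < 1"
    and C: "\<And>x n i. u \<bullet> x = 0 \<Longrightarrow> \<bar>(matrix_power T n *v x) $ i\<bar> \<le> C * norm x * (y * \<epsilon>) ^ n"
    using perron_contraction[OF pt] by blast
  have y: "y > 0" and ev: "T *v v = y *\<^sub>R v" using pt by (simp_all add: perron_triple_def)
  define c where "c = (u \<bullet> \<eta>) / (u \<bullet> v)"
  define x where "x = \<eta> - c *\<^sub>R v"
  have x: "u \<bullet> x = 0" using perron_decomposition[OF pt] by (simp add: x_def c_def)
  define e where "e n = (\<xi> \<bullet> (matrix_power T n *v x)) / y ^ n" for n
  define D where "D = (\<Sum>i\<in>UNIV. \<bar>\<xi> $ i\<bar>) * (C * norm x)"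
  have e: "\<bar>e n\<bar> \<le> D * \<epsilon> ^ n" for n
  proof -
    have "\<bar>\<xi> \<bullet> (matrix_power T n *v x)\<bar> \<le> (\<Sum>i\<in>UNIV. \<bar>\<xi> $ i * (matrix_power T n *v x) $ i\<bar>)"
      unfolding inner_vec_def by (simp add: sum_abs)
    also have "\<dots> \<le> (\<Sum>i\<in>UNIV. \<bar>\<xi> $ i\<bar> * (C * norm x * (y * \<epsilon>) ^ n))"
      using C[OF x] by (intro sum_mono) (auto simp: abs_mult intro!: mult_left_mono)
    also have "\<dots> = D * (y * \<epsilon>) ^ n" by (simp add: D_def sum_distrib_left sum_distrib_right mult_ac)
    finally show ?thesis using y by (simp add: e_def field_simps power_mult_distrib)
  qed
  have "\<xi> \<bullet> (matrix_power T n *v \<eta>) = y ^ n * ((\<xi> \<bullet> v) * (u \<bullet> \<eta>) / (u \<bullet> v) + e n)" for n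
  proof -
    have "\<eta> = c *\<^sub>R v + x" by (simp add: x_def)
    then have "\<xi> \<bullet> (matrix_power T n *v \<eta>) = c * y ^ n * (\<xi> \<bullet> v) + \<xi> \<bullet> (matrix_power T n *v x)"
      by (simp add: matrix_vector_right_distrib matrix_vector_mult_scaleR inner_add_right
          matrix_power_eigenvector[OF ev])
    then show ?thesis using y by (simp add: e_def c_def field_simps)
  qed
  with e \<epsilon> show ?thesis by blast
qed

text \<open>Needed because the perturbation argument produces eigenvectors of a power only. Pairing
  with \<open>u\<close> forces \<open>\<kappa> = y ^ N\<close>. The component \<open>x\<close> of
  \<open>V\<close> orthogonal to \<open>u\<close> is then multiplied by \<open>y ^ N\<close> in
  every \<open>N\<close> steps, which the decay on that hyperplane allows only for
  \<open>x = 0\<close>.\<close>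

lemma perron_eigenvector_unique:
  fixes T :: "real^'m^'m"
  assumes pt: "perron_triple T y v u" and "N \<ge> 1"
    and V: "\<And>i. V $ i > 0" "matrix_power T N *v V = \<kappa> *\<^sub>R V"
  shows "V = ((u \<bullet> V) / (u \<bullet> v)) *\<^sub>R v"
proof -
  obtain \<epsilon> C where \<epsilon>: "0 < \<epsilon>" "\<epsilon> < 1"
    and C: "\<And>x n i. u \<bullet> x = 0 \<Longrightarrow> \<bar>(matrix_power T n *v x) $ i\<bar> \<le> C * norm x * (y * \<epsilon>) ^ n"
    using perron_contraction[OF pt] by blast
  have y: "y > 0" and ev: "T *v v = y *\<^sub>R v" and u: "\<And>i. u $ i > 0"
    using pt by (simp_all add: perron_triple_def)
  have "\<kappa> * (u \<bullet> V) = y ^ N * (u \<bullet> V)"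
    using inner_matrix_power[OF pt, of N V] V(2) by simp
  then have \<kappa>: "\<kappa> = y ^ N" using inner_pos[OF u V(1)] by simp
  define x where "x = V - ((u \<bullet> V) / (u \<bullet> v)) *\<^sub>R v"
  have x: "u \<bullet> x = 0" using perron_decomposition[OF pt] by (simp add: x_def)
  have "matrix_power T N *v x = y ^ N *\<^sub>R x"
    by (simp add: x_def matrix_vector_mult_diff_distrib matrix_vector_mult_scaleR
        matrix_power_eigenvector[OF ev] V(2) \<kappa> scaleR_diff_right)
  then have pow: "matrix_power T (N * n) *v x = (y ^ N) ^ n *\<^sub>R x" for n
    unfolding matrix_power_mult by (rule matrix_power_eigenvector)
  have "x $ i = 0" for i
  proof (rule ccontr)
    assume "x $ i \<noteq> 0"
    have le: "(y ^ N) ^ n * \<bar>x $ i\<bar> \<le> C * norm x * ((y * \<epsilon>) ^ N) ^ n" for n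
      using C[OF x, of "N * n" i] y by (simp add: pow abs_mult power_mult)
    have "y ^ N \<le> (y * \<epsilon>) ^ N"
      by (rule power_growth_le[OF le]) (use \<open>x $ i \<noteq> 0\<close> y \<epsilon> in auto)
    then have "y ^ N * 1 \<le> y ^ N * \<epsilon> ^ N" by (simp add: power_mult_distrib)
    then have "1 \<le> \<epsilon> ^ N" using y by (simp only: mult_le_cancel_left_pos zero_less_power)
    moreover have "\<epsilon> ^ N < 1" using \<epsilon> \<open>N \<ge> 1\<close> by (intro power_less_one_iff[THEN iffD2]) auto
    ultimately show False by simp
  qed
  then show ?thesis by (simp add: x_def vec_eq_iff)
qed

section \<open>Analytic dependence of the Perron eigenvector\<close>

lemma power_series_le_diff:
  assumes "\<rho> > 0" "power_series_le \<rho> K f" "power_series_le \<rho> L g" shows "power_series_le \<rho> (K + L) (\<lambda>h. f h - g h)"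
  using power_series_le_add[OF assms(1,2) power_series_le_cmult[OF assms(1,3), of "-1"]] by simp

lemma power_series_le_matrix_vector:
  fixes E :: "real^'l::finite \<Rightarrow> real^'m^'m"
  assumes "\<rho> > 0" "\<And>i j. power_series_le \<rho> \<delta> (\<lambda>h. E h $ i $ j)" "\<And>j. power_series_le \<rho> K (\<lambda>h. V h $ j)"
  shows "power_series_le \<rho> (real CARD('m) * (\<delta> * K)) (\<lambda>h. (E h *v V h) $ i)"
  using power_series_le_sum[OF assms(1) finite power_series_le_mult[OF assms(1) assms(2)[of i] assms(3)]]
  by (simp add: matrix_vector_mult_def)

lemma power_series_le_inner:
  fixes u :: "real^'m" and V :: "real^'l::finite \<Rightarrow> real^'m"
  assumes "\<rho> > 0" "\<And>j. power_series_le \<rho> K (\<lambda>h. V h $ j)"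
  shows "power_series_le \<rho> ((\<Sum>i\<in>UNIV. \<bar>u $ i\<bar>) * K) (\<lambda>h. u \<bullet> V h)"
  using power_series_le_sum[OF assms(1) finite power_series_le_cmult[OF assms(1) assms(2)]]
  by (simp add: inner_vec_def sum_distrib_right)

text \<open>With \<open>V\<close> scaled so that u'V = 1, the equation (v u' + E) V = \<kappa> V
  reads v + E V = \<kappa> V. When u'v = 1, applying u' gives \<kappa> = 1 + u'E V, and substituting
  this yields \<open>V = secular_map v u E V\<close>.\<close>

definition secular_map :: "real^'m \<Rightarrow> real^'m \<Rightarrow> real^'m^'m \<Rightarrow> real^'m \<Rightarrow> real^'m" where
  "secular_map v u E V = v + E *v V - (u \<bullet> (E *v V)) *\<^sub>R V"

text \<open>The quadratic term is split as in the product rule, so that each summand is linear in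
  \<open>V - W\<close> and can be estimated by the contraction constant.\<close>

lemma secular_map_diff:
  "secular_map v u E V - secular_map v u E W =
     E *v (V - W) - ((u \<bullet> (E *v V)) *\<^sub>R (V - W) + (u \<bullet> (E *v (V - W))) *\<^sub>R W)"
  by (simp add: secular_map_def matrix_vector_mult_diff_distrib inner_diff_right algebra_simps)

text \<open>The scaling u'V = 1 is recovered rather than assumed: applying u' to the fixed point
  equation gives (u'V - 1)(1 + u'E V) = 0, and the hypothesis \<open>ne\<close> excludes the second
  factor.\<close>

lemma secular_map_fixed_point:
  fixes u v V :: "real^'m"
  assumes uv: "u \<bullet> v = 1" and V: "secular_map v u E V = V" and ne: "u \<bullet> (E *v V) \<noteq> - 1"
  shows "(\<chi> i j. v $ i * u $ j + E $ i $ j) *v V = (1 + u \<bullet> (E *v V)) *\<^sub>R V"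
proof -
  define F where "F = E *v V"
  have eq: "V = v + F - (u \<bullet> F) *\<^sub>R V" using V by (simp add: secular_map_def F_def)
  have "u \<bullet> V = 1 + u \<bullet> F - (u \<bullet> F) * (u \<bullet> V)"
    using arg_cong[OF eq, of "\<lambda>x. u \<bullet> x"] uv by (simp add: inner_diff_right inner_add_right)
  then have "(u \<bullet> V - 1) * (1 + u \<bullet> F) = 0" by (simp add: algebra_simps)
  then have uV: "u \<bullet> V = 1" using ne by (auto simp: F_def)
  have "(\<chi> i j. v $ i * u $ j + E $ i $ j) *v V = (u \<bullet> V) *\<^sub>R v + F"
    by (simp add: vec_eq_iff F_def matrix_vector_mult_def inner_vec_def distrib_right distrib_left
        sum.distrib sum_distrib_left sum_distrib_right mult_ac)
  also have "\<dots> = V + (u \<bullet> F) *\<^sub>R V" using eq uV by (simp add: algebra_simps)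
  finally show ?thesis by (simp add: F_def scaleR_add_left)
qed

text \<open>For a rank one matrix plus a small perturbation the eigenvector is the fixed point of a
  contraction, whose iterates are power series with geometrically decaying increments.\<close>

lemma rank_one_perturbation_eigenvector:
  fixes u v :: "real^'m"
  assumes uv: "u \<bullet> v = 1"
  shows "\<exists>\<delta>>0. \<forall>(E :: real^'l::finite \<Rightarrow> real^'m^'m) \<rho>. \<rho> > 0 \<longrightarrow>
    (\<forall>i j. power_series_le \<rho> \<delta> (\<lambda>h. E h $ i $ j)) \<longrightarrow> E 0 *v v = 0 \<longrightarrow>
    (\<exists>V. (\<forall>i. analytic_at_0 (\<lambda>h. V h $ i)) \<and> V 0 = v \<and>
      (\<forall>h\<in>cube \<rho>. \<exists>\<kappa>. (\<chi> i j. v $ i * u $ j + E h $ i $ j) *v V h = \<kappa> *\<^sub>R V h))"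
proof -
  \<comment> \<open>\<open>R\<close> bounds the iterates, and \<open>m\<close> enters through the
    row sums of a matrix-vector product. The value of \<open>\<delta>\<close> makes three estimates
    hold at once: each component of an iterate stays within coefficient distance 1 of that of
    \<open>v\<close> (\<open>b1\<close>), increments are halved in each step (\<open>b2\<close>),
    and |u'E V| stays below 1 (\<open>b3\<close>), which keeps it away from the excluded value
    -1.\<close>
  define U where "U = (\<Sum>i\<in>UNIV. \<bar>u $ i\<bar>)"
  define R where "R = 1 + norm v"
  define m where "m = real CARD('m)"
  define \<delta> where "\<delta> = 1 / (2 * m * (1 + 2 * U * R) * R)"
  have U: "U \<ge> 0" by (auto simp: U_def intro: sum_nonneg)
  have R: "R \<ge> 1" by (simp add: R_def)
  have m: "m \<ge> 1" by (simp add: m_def Suc_le_eq)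
  have q: "1 + 2 * U * R > 0" using U R by (simp add: add_pos_nonneg)
  have \<delta>: "\<delta> > 0" using m q R by (auto simp: \<delta>_def intro!: divide_pos_pos mult_pos_pos)
  have \<delta>eq: "m * \<delta> * (1 + 2 * U * R) * R = 1 / 2"
    using m q R by (simp add: \<delta>_def)
  have UR: "U * R \<ge> 0" using U R by simp
  have b1: "m * (\<delta> * R) + U * (m * (\<delta> * R)) * R \<le> 1"
  proof -
    have "m * \<delta> * (1 + U * R) * R \<le> m * \<delta> * (1 + 2 * U * R) * R"
      using m \<delta> U R UR by (intro mult_right_mono mult_left_mono) auto
    then show ?thesis using \<delta>eq by (simp add: algebra_simps)
  qed
  have b2: "m * (\<delta> * D) + (U * (m * (\<delta> * R)) * D + U * (m * (\<delta> * D)) * R) \<le> D / 2"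
    if "D \<ge> 0" for D
  proof -
    have "m * \<delta> * (1 + 2 * U * R) * 1 \<le> m * \<delta> * (1 + 2 * U * R) * R"
      using m \<delta> q R by (intro mult_left_mono) auto
    then have "m * \<delta> * (1 + 2 * U * R) \<le> 1 / 2" by (simp add: \<delta>eq)
    then have "m * \<delta> * (1 + 2 * U * R) * D \<le> 1 / 2 * D" using that by (rule mult_right_mono)
    then show ?thesis by (simp add: algebra_simps)
  qed
  have b3: "U * (m * (\<delta> * R)) < 1"
  proof -
    have "2 * (U * (m * (\<delta> * R))) \<le> m * \<delta> * (1 + 2 * U * R)"
      using m \<delta> by (simp add: algebra_simps)
    also have "\<dots> \<le> m * \<delta> * (1 + 2 * U * R) * R"
      using m \<delta> q R by (intro mult_right_le_one_le[THEN order_trans, rotated -1] mult_left_mono[of 1 R, simplified]) auto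
    finally show ?thesis by (simp add: \<delta>eq)
  qed
  have "\<exists>V. (\<forall>i. analytic_at_0 (\<lambda>h. V h $ i)) \<and> V 0 = v \<and>
      (\<forall>h\<in>cube \<rho>. \<exists>\<kappa>. (\<chi> i j. v $ i * u $ j + E h $ i $ j) *v V h = \<kappa> *\<^sub>R V h)"
    if rho: "\<rho> > 0" and E: "\<And>i j. power_series_le \<rho> \<delta> (\<lambda>h. E h $ i $ j)" and E0: "E 0 *v v = 0"
    for E :: "real^'l \<Rightarrow> real^'m^'m" and \<rho>
  proof -
    note mv = power_series_le_matrix_vector[OF rho E, folded m_def]
    note inn = power_series_le_inner[OF rho, of _ _ u, folded U_def]
    define W where "W n h = (secular_map v u (E h) ^^ n) v" for n h
    have W0: "W 0 h = v" for h by (simp add: W_def)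
    have WS: "W (Suc n) h = secular_map v u (E h) (W n h)" for n h by (simp add: W_def)
    have incr: "power_series_le \<rho> 1 (\<lambda>h. secular_map v u (E h) (X h) $ i - v $ i)"
      if X: "\<And>i. power_series_le \<rho> R (\<lambda>h. X h $ i)" for X i
    proof -
      note F = mv[OF X]
      have "power_series_le \<rho> (m * (\<delta> * R) + U * (m * (\<delta> * R)) * R)
          (\<lambda>h. (E h *v X h) $ i - (u \<bullet> (E h *v X h)) * X h $ i)"
        by (rule power_series_le_diff[OF rho F power_series_le_mult[OF rho inn[OF F] X]])
      from power_series_le_mono[OF this b1] show ?thesis by (simp add: secular_map_def algebra_simps)
    qed
    have WR: "power_series_le \<rho> R (\<lambda>h. W n h $ i)" for n i
    proof (induction n arbitrary: i)
      case 0
      show ?case unfolding W0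
        by (rule power_series_le_mono[OF power_series_le_const[OF rho]])
           (use component_le_norm_cart[of v i] in \<open>simp add: R_def\<close>)
    next
      case (Suc n)
      have "power_series_le \<rho> (1 + \<bar>v $ i\<bar>) (\<lambda>h. (W (Suc n) h $ i - v $ i) + v $ i)"
        unfolding WS by (rule power_series_le_add[OF rho incr[OF Suc] power_series_le_const[OF rho]])
      moreover have "1 + \<bar>v $ i\<bar> \<le> R"
        using component_le_norm_cart[of v i] by (simp add: R_def)
      ultimately show ?case using power_series_le_mono by fastforce
    qed
    have diff: "power_series_le \<rho> ((1/2) ^ n) (\<lambda>h. (W (Suc n) h - W n h) $ i)" for n i
    proof (induction n arbitrary: i)
      case 0
      show ?case unfolding WS using incr[OF WR, of 0] by (simp add: W0)
    next
      case (Suc n)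
      define D :: real where "D = (1/2) ^ n"
      note IH = Suc[folded D_def]
      have "power_series_le \<rho> (m * (\<delta> * D) + (U * (m * (\<delta> * R)) * D + U * (m * (\<delta> * D)) * R))
         (\<lambda>h. (E h *v (W (Suc n) h - W n h)) $ i -
           ((u \<bullet> (E h *v W (Suc n) h)) * (W (Suc n) h - W n h) $ i +
            (u \<bullet> (E h *v (W (Suc n) h - W n h))) * W n h $ i))"
        by (intro power_series_le_diff power_series_le_add power_series_le_mult rho mv inn IH WR)
      then have "power_series_le \<rho> (m * (\<delta> * D) + (U * (m * (\<delta> * R)) * D + U * (m * (\<delta> * D)) * R))
         (\<lambda>h. (W (Suc (Suc n)) h - W (Suc n) h) $ i)"
        unfolding WS[of "Suc n"] WS[of n] secular_map_diff[of _ _ _ "secular_map _ _ _ _"] by simp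
      from power_series_le_mono[OF this b2] show ?case by (simp add: D_def)
    qed
    \<comment> \<open>The limit is written for every \<open>h\<close>, but convergence is claimed
      only on the cube.\<close>
    define V where "V h = (\<chi> i. lim (\<lambda>n. W n h $ i))" for h
    have sums: "(\<lambda>n. (W (Suc n) h - W n h) $ i) sums (V h $ i - v $ i)"
      and lim: "(\<lambda>n. W n h $ i) \<longlonglongrightarrow> V h $ i" if h: "h \<in> cube \<rho>" for h i
    proof -
      have "summable (\<lambda>n. (W (Suc n) h - W n h) $ i)"
      proof (rule summable_comparison_test)
        show "\<exists>N. \<forall>n\<ge>N. norm ((W (Suc n) h - W n h) $ i) \<le> (1/2) ^ n"
          using power_series_le_bound[OF diff h] by simp
      qed (simp add: summable_geometric)
      then have "convergent (\<lambda>n. \<Sum>k<n. (W (Suc k) h $ i - W k h $ i))"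
        by (simp add: summable_iff_convergent)
      then have "convergent (\<lambda>n. W n h $ i - v $ i)"
        by (simp add: sum_lessThan_telescope[of "\<lambda>k. W k h $ i"] W0)
      from convergent_add[OF this convergent_const[of "v $ i"]]
      show l: "(\<lambda>n. W n h $ i) \<longlonglongrightarrow> V h $ i"
        by (simp add: V_def convergent_LIMSEQ_iff)
      show "(\<lambda>n. (W (Suc n) h - W n h) $ i) sums (V h $ i - v $ i)"
        unfolding sums_def using tendsto_diff[OF l tendsto_const[of "v $ i"]]
        by (simp add: sum_lessThan_telescope[of "\<lambda>k. W k h $ i"] W0)
    qed
    have "analytic_at_0 (\<lambda>h. V h $ i)" for i
    proof -
      have "power_series_le \<rho> 2 (\<lambda>h. V h $ i - v $ i)"
        by (rule power_series_le_sums[OF rho diff _ sums]) (use geometric_sums[of "1/2::real"] in simp_all)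
      from analytic_at_0_add[OF analytic_at_0I[OF rho this] analytic_at_0_const[of "v $ i"]] show ?thesis by simp
    qed
    \<comment> \<open>As \<open>E 0\<close> annihilates \<open>v\<close>, the starting vector is
      already fixed at the origin and the iteration is constant there.\<close>
    moreover have "V 0 = v"
    proof -
      have "W n 0 = v" for n
        by (induction n) (simp_all add: W0 WS secular_map_def E0)
      then show ?thesis by (simp add: V_def vec_eq_iff)
    qed
    moreover have "\<exists>\<kappa>. (\<chi> i j. v $ i * u $ j + E h $ i $ j) *v V h = \<kappa> *\<^sub>R V h"
      if h: "h \<in> cube \<rho>" for h
    proof -
      have limV: "(\<lambda>n. W n h) \<longlonglongrightarrow> V h" using lim[OF h] by (intro vec_tendstoI)
      have limEV: "(\<lambda>n. E h *v W n h) \<longlonglongrightarrow> E h *v V h"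
        by (rule bounded_linear.tendsto[OF matrix_vector_mul_bounded_linear limV])
      have "(\<lambda>n. W (Suc n) h) \<longlonglongrightarrow> secular_map v u (E h) (V h)"
        unfolding WS secular_map_def by (intro tendsto_intros limV limEV)
      with LIMSEQ_Suc[OF limV] have fp: "secular_map v u (E h) (V h) = V h"
        by (rule LIMSEQ_unique[symmetric])
      \<comment> \<open>The bound for the iterates survives as a weak inequality in the limit; the
        strict inequality \<open>b3\<close> then excludes -1.\<close>
      have "\<bar>u \<bullet> (E h *v W n h)\<bar> \<le> U * (m * (\<delta> * R))" for n
        by (rule power_series_le_bound[OF inn[OF mv[OF WR]] h])
      moreover have "(\<lambda>n. \<bar>u \<bullet> (E h *v W n h)\<bar>) \<longlonglongrightarrow> \<bar>u \<bullet> (E h *v V h)\<bar>"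
        by (intro tendsto_intros limEV)
      ultimately have "\<bar>u \<bullet> (E h *v V h)\<bar> \<le> U * (m * (\<delta> * R))"
        by (intro LIMSEQ_le_const2[where X="\<lambda>n. \<bar>u \<bullet> (E h *v W n h)\<bar>"]) auto
      then have "u \<bullet> (E h *v V h) \<noteq> - 1" using b3 by auto
      from secular_map_fixed_point[OF uv fp this] show ?thesis by blast
    qed
    ultimately show ?thesis by blast
  qed
  with \<delta> show ?thesis by blast
qed

section \<open>Analytic families of primitive matrices\<close>

lemma analytic_at_0_matrix_power:
  fixes M :: "real^'l::finite \<Rightarrow> real^'m^'m"
  assumes "\<And>i j. analytic_at_0 (\<lambda>h. M h $ i $ j)"
  shows "analytic_at_0 (\<lambda>h. matrix_power (M h) n $ i $ j)"
proof (induction n arbitrary: i j)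
  case 0
  then show ?case by (simp add: analytic_at_0_const)
next
  case (Suc n)
  show ?case unfolding matrix_power.simps matrix_matrix_mult_def
    by (simp add: analytic_at_0_sum analytic_at_0_mult assms Suc)
qed

text \<open>The asymptotics applied to pairs of unit vectors give every entry separately; there are
  finitely many, so one exponent serves them all.\<close>

lemma perron_power_near_rank_one:
  assumes pt: "perron_triple T y v u" and "\<delta> > 0"
  shows "\<exists>N\<ge>1. \<forall>i j. \<bar>matrix_power T N $ i $ j / y ^ N - v $ i * u $ j / (u \<bullet> v)\<bar> \<le> \<delta>"
proof -
  have y: "y > 0" using pt by (simp add: perron_triple_def)
  have "\<forall>\<^sub>F N in sequentially. \<bar>matrix_power T N $ i $ j / y ^ N - v $ i * u $ j / (u \<bullet> v)\<bar> \<le> \<delta>" for i j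
  proof -
    obtain \<epsilon> D e where \<epsilon>: "0 < \<epsilon>" "\<epsilon> < 1" and e: "\<And>n. \<bar>e n\<bar> \<le> D * \<epsilon> ^ n"
      and eq: "\<And>n. axis i 1 \<bullet> (matrix_power T n *v axis j 1) =
        y ^ n * ((axis i 1 \<bullet> v) * (u \<bullet> axis j 1) / (u \<bullet> v) + e n)"
      using perron_asymptotics[OF pt, of "axis i 1" "axis j 1"] by blast
    have "(\<lambda>n. D * \<epsilon> ^ n) \<longlonglongrightarrow> D * 0"
      using \<epsilon> by (intro tendsto_intros LIMSEQ_power_zero) auto
    then have "\<forall>\<^sub>F n in sequentially. D * \<epsilon> ^ n < \<delta>"
      using \<open>\<delta> > 0\<close> by (auto dest: order_tendstoD(2))
    then show ?thesis
    proof eventually_elim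
      case (elim n)
      have "matrix_power T n $ i $ j = y ^ n * (v $ i * u $ j / (u \<bullet> v) + e n)"
        using eq[of n] by (simp add: inner_axis inner_axis' matrix_vector_mul_component inner_commute[of _ "axis j 1"])
      then show ?case using y e[of n] elim by simp
    qed
  qed
  then have "\<forall>\<^sub>F N in sequentially. N \<ge> 1 \<and>
      (\<forall>i j. \<bar>matrix_power T N $ i $ j / y ^ N - v $ i * u $ j / (u \<bullet> v)\<bar> \<le> \<delta>)"
    by (intro eventually_conj eventually_ge_at_top) (simp add: eventually_all_finite)
  then show ?thesis by (auto dest: eventually_happens)
qed

lemma analytic_at_0_perron_eigenvector:
  fixes M :: "real^'l::finite \<Rightarrow> real^'m^'m"
  assumes M: "\<And>i j. analytic_at_0 (\<lambda>h. M h $ i $ j)" and pt: "perron_triple (M 0) y v u"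
  shows "\<exists>N\<ge>1. \<exists>V. (\<forall>i. analytic_at_0 (\<lambda>h. V h $ i)) \<and> V 0 = v \<and>
    (\<exists>\<rho>>0. \<forall>h\<in>cube \<rho>. (\<forall>i. V h $ i > 0) \<and> (\<exists>\<kappa>. matrix_power (M h) N *v V h = \<kappa> *\<^sub>R V h))"
proof -
  have y: "y > 0" and v: "\<And>i. v $ i > 0" and uv0: "u \<bullet> v > 0"
    and ev: "M 0 *v v = y *\<^sub>R v"
    using pt inner_pos[of u v] by (simp_all add: perron_triple_def)
  define u' where "u' = (1 / (u \<bullet> v)) *\<^sub>R u"
  have uv: "u' \<bullet> v = 1" using uv0 by (simp add: u'_def)
  obtain \<delta> where \<delta>: "\<delta> > 0" and step: "\<And>(E :: real^'l \<Rightarrow> real^'m^'m) \<rho>. \<rho> > 0 \<Longrightarrow>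
    (\<forall>i j. power_series_le \<rho> \<delta> (\<lambda>h. E h $ i $ j)) \<Longrightarrow> E 0 *v v = 0 \<Longrightarrow>
    (\<exists>V. (\<forall>i. analytic_at_0 (\<lambda>h. V h $ i)) \<and> V 0 = v \<and>
      (\<forall>h\<in>cube \<rho>. \<exists>\<kappa>. (\<chi> i j. v $ i * u' $ j + E h $ i $ j) *v V h = \<kappa> *\<^sub>R V h))"
    using rank_one_perturbation_eigenvector[OF uv, where 'l='l] by blast
  \<comment> \<open>Only half of \<open>\<delta>\<close> is spent on the value at the origin. The
    other half absorbs the excess of the coefficient norm over that value on a small cube.\<close>
  obtain N where N: "N \<ge> 1"
    "\<And>i j. \<bar>matrix_power (M 0) N $ i $ j / y ^ N - v $ i * u' $ j\<bar> \<le> \<delta> / 2"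
    using perron_power_near_rank_one[OF pt, of "\<delta> / 2"] \<delta> by (auto simp: u'_def)
  \<comment> \<open>The power is divided by the constant \<open>y ^ N\<close> belonging to
    \<open>M 0\<close>, not by an eigenvalue varying with \<open>h\<close>, so the entries of
    \<open>E\<close> are analytic because those of \<open>M\<close> are.\<close>
  define E where "E h = (\<chi> i j. matrix_power (M h) N $ i $ j / y ^ N - v $ i * u' $ j)" for h
  have Emat: "(\<chi> i j. v $ i * u' $ j + E h $ i $ j) *v x = (1 / y ^ N) *\<^sub>R (matrix_power (M h) N *v x)" for h x
    by (simp add: E_def vec_eq_iff matrix_vector_mult_def sum_divide_distrib)
  have gE: "analytic_at_0 (\<lambda>h. E h $ i $ j)" for i j
    using analytic_at_0_diff[OF analytic_at_0_mult[OF analytic_at_0_matrix_power[of M N i j, OF M] analytic_at_0_const[of "1 / y ^ N"]] analytic_at_0_const[of "v $ i * u' $ j"]]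
    by (simp add: E_def)
  have "\<forall>\<^sub>F \<rho> in at_right 0. power_series_le \<rho> \<delta> (\<lambda>h. E h $ i $ j)" for i j
  proof -
    have "\<bar>E 0 $ i $ j\<bar> + \<delta> / 2 \<le> \<delta>" using N(2)[of i j] by (simp add: E_def)
    with analytic_at_0_small[OF gE[of i j] half_gt_zero[OF \<delta>]] show ?thesis
      by (auto elim!: eventually_mono intro: power_series_le_mono)
  qed
  then have "\<forall>\<^sub>F \<rho> in at_right 0. \<rho> > 0 \<and> (\<forall>i j. power_series_le \<rho> \<delta> (\<lambda>h. E h $ i $ j))"
    by (intro eventually_conj eventually_pos_at_right) (simp add: eventually_all_finite)
  then obtain \<rho>1 where \<rho>1: "\<rho>1 > 0" "\<forall>i j. power_series_le \<rho>1 \<delta> (\<lambda>h. E h $ i $ j)"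
    by (auto dest: eventually_happens)
  \<comment> \<open>Both the rescaled power at the origin and the rank one matrix fix
    \<open>v\<close>.\<close>
  have "E 0 *v v = 0"
  proof -
    have "E 0 *v v = (1 / y ^ N) *\<^sub>R (matrix_power (M 0) N *v v) - (u' \<bullet> v) *\<^sub>R v"
      by (simp add: E_def vec_eq_iff matrix_vector_mult_def sum_divide_distrib inner_vec_def
          left_diff_distrib right_diff_distrib sum_subtractf sum_distrib_left sum_distrib_right mult_ac)
    then show ?thesis using y by (simp add: matrix_power_eigenvector[OF ev] uv)
  qed
  from step[OF \<rho>1 this] obtain V where V: "\<And>i. analytic_at_0 (\<lambda>h. V h $ i)" "V 0 = v"
    and eig: "\<And>h. h \<in> cube \<rho>1 \<Longrightarrow> \<exists>\<kappa>. (\<chi> i j. v $ i * u' $ j + E h $ i $ j) *v V h = \<kappa> *\<^sub>R V h"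
    by blast
  have eig': "\<exists>\<kappa>. matrix_power (M h) N *v V h = \<kappa> *\<^sub>R V h" if h: "h \<in> cube \<rho>1" for h
  proof -
    obtain \<kappa> where "(1 / y ^ N) *\<^sub>R (matrix_power (M h) N *v V h) = \<kappa> *\<^sub>R V h"
      using eig[OF h] unfolding Emat by blast
    then have "y ^ N *\<^sub>R ((1 / y ^ N) *\<^sub>R (matrix_power (M h) N *v V h)) = (y ^ N * \<kappa>) *\<^sub>R V h"
      by simp
    then show ?thesis using y by auto
  qed
  \<comment> \<open>Positivity is inherited from \<open>v\<close> by continuity. It is what later
    identifies \<open>V h\<close> as a multiple of the Perron vector of \<open>M h\<close>.\<close>
  have "\<forall>\<^sub>F \<rho> in at_right 0. \<forall>h\<in>cube \<rho>. V h $ i > 0" for i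
  proof -
    have pos: "\<bar>a - v $ i\<bar> \<le> v $ i / 2 \<Longrightarrow> a > 0" for a using v[of i] by linarith
    from analytic_at_0_close[OF V(1)[of i] half_gt_zero[OF v[of i]]] show ?thesis
      unfolding V(2) by (auto elim!: eventually_mono intro: pos)
  qed
  then have "\<forall>\<^sub>F \<rho> in at_right 0. \<rho> > 0 \<and> \<rho> < \<rho>1 \<and> (\<forall>i. \<forall>h\<in>cube \<rho>. V h $ i > 0)"
    using \<rho>1(1) by (intro eventually_conj eventually_pos_at_right)
      (auto simp: eventually_all_finite eventually_at_right intro!: exI[of _ \<rho>1])
  then obtain \<rho> where \<rho>: "\<rho> > 0" "\<rho> < \<rho>1" "\<forall>i. \<forall>h\<in>cube \<rho>. V h $ i > 0"
    by (auto dest: eventually_happens)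
  moreover have "cube \<rho> \<subseteq> (cube \<rho>1 :: (real^'l) set)"
    using \<rho> by (auto simp: cube_def intro: order_trans less_imp_le)
  ultimately have "\<forall>h\<in>cube \<rho>. (\<forall>i. V h $ i > 0) \<and>
      (\<exists>\<kappa>. matrix_power (M h) N *v V h = \<kappa> *\<^sub>R V h)"
    using eig' by blast
  with N(1) V \<rho>(1) show ?thesis by blast
qed

section \<open>Symbol statistics\<close>

text \<open>The letter b gets exponent 0, so that M(t) becomes one sum over the whole alphabet, each
  letter entering with the exponential of its weight.\<close>

definition letter_weight :: "real^'l \<Rightarrow> 'l option \<Rightarrow> real" where
  "letter_weight t x = (case x of None \<Rightarrow> 0 | Some i \<Rightarrow> t $ i)"

lemma inner_symbol_counts_Nil: "t \<bullet> symbol_counts [] = 0"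
  by (simp add: inner_vec_def symbol_counts_def)

lemma inner_symbol_counts_Cons:
  "t \<bullet> symbol_counts (x # w) = letter_weight t x + t \<bullet> symbol_counts w"
proof -
  have "t \<bullet> symbol_counts (x # w) =
      (\<Sum>i\<in>UNIV. (if x = Some i then t $ i else 0) + t $ i * real (count_list w (Some i)))"
    by (auto simp: inner_vec_def symbol_counts_def algebra_simps intro!: sum.cong)
  also have "\<dots> = (\<Sum>i\<in>UNIV. if x = Some i then t $ i else 0) + t \<bullet> symbol_counts w"
    by (simp add: sum.distrib inner_vec_def symbol_counts_def)
  also have "(\<Sum>i\<in>UNIV. if x = Some i then t $ i else 0) = letter_weight t x"
    by (cases x) (simp_all add: letter_weight_def)
  finally show ?thesis .
qed

lemma tilted_matrix_mult_vec:
  "tilted_matrix A B t *v z = (\<Sum>x\<in>UNIV. exp (letter_weight t x) *\<^sub>R (symbol_matrix A B x *v z))"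
proof -
  have "(\<Sum>i\<in>I. exp (t $ i) *\<^sub>R A i) *v z = (\<Sum>i\<in>I. exp (t $ i) *\<^sub>R (A i *v z))" for I
    by (induction I rule: infinite_finite_induct)
       (simp_all add: matrix_vector_mult_add_rdistrib scaleR_matrix_vector_assoc)
  then show ?thesis
    by (simp add: tilted_matrix_def UNIV_option_conv sum.reindex letter_weight_def
        matrix_vector_mult_add_rdistrib)
qed

lemma finite_words: "finite (words n :: 'a::finite list set)"
  using finite_lists_length_eq[of "UNIV :: 'a set" n] by (simp add: words_def)

lemma words_Suc: "words (Suc n) = (\<lambda>(x, w). x # w) ` (UNIV \<times> words n)"
  by (auto simp: words_def length_Suc_conv image_iff)

text \<open>The exponential of the counts is multiplicative along a word, so splitting off the first
  letter peels one factor M(t) off on the left.\<close>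

lemma sum_words_tilted:
  fixes A :: "'l::finite \<Rightarrow> real^'m^'m"
  shows "(\<Sum>w\<in>words n. exp (t \<bullet> symbol_counts w) *\<^sub>R (word_matrix A B w *v \<eta>)) =
     matrix_power (tilted_matrix A B t) n *v \<eta>"
proof (induction n)
  case 0
  have "words 0 = {[] :: 'l option list}" by (auto simp: words_def)
  then show ?case by (simp add: inner_symbol_counts_Nil)
next
  case (Suc n)
  have inj: "inj_on (\<lambda>(x, w). x # w) (UNIV \<times> words n :: ('l option \<times> 'l option list) set)"
    by (auto simp: inj_on_def)
  have "(\<Sum>w\<in>words (Suc n). exp (t \<bullet> symbol_counts w) *\<^sub>R (word_matrix A B w *v \<eta>)) =
    (\<Sum>x\<in>UNIV. \<Sum>w\<in>words n. exp (letter_weight t x) *\<^sub>R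
       (exp (t \<bullet> symbol_counts w) *\<^sub>R (symbol_matrix A B x *v (word_matrix A B w *v \<eta>))))"
    unfolding words_Suc sum.reindex[OF inj]
    by (simp add: sum.cartesian_product inner_symbol_counts_Cons
        exp_add matrix_vector_mul_assoc case_prod_unfold)
  also have "\<dots> = tilted_matrix A B t *v
      (\<Sum>w\<in>words n. exp (t \<bullet> symbol_counts w) *\<^sub>R (word_matrix A B w *v \<eta>))"
    by (simp add: tilted_matrix_mult_vec linear_sum[OF matrix_vector_mul_linear]
        matrix_vector_mult_scaleR scaleR_sum_right)
       (subst sum.swap, simp add: mult.commute)
  finally show ?case by (simp add: Suc matrix_vector_mul_assoc)
qed

lemma tilted_matrix_0: "tilted_matrix A B 0 = total_matrix A B"
  by (simp add: tilted_matrix_def total_matrix_def)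

lemma matrix_vector_nonneg:
  fixes T :: "real^'m^'m"
  assumes "0 \<le> T" "0 \<le> x" shows "0 \<le> T *v x"
  using assms by (auto simp: less_eq_vec_def matrix_vector_mult_def intro!: sum_nonneg)

lemma inner_nonneg:
  fixes x y :: "real^'m" assumes "0 \<le> x" "0 \<le> y" shows "0 \<le> x \<bullet> y"
  using assms by (auto simp: less_eq_vec_def inner_vec_def intro!: sum_nonneg)

lemma word_weight_nonneg:
  assumes "0 \<le> \<xi>" "0 \<le> \<eta>" "\<And>i. 0 \<le> A i" "0 \<le> B"
  shows "0 \<le> word_weight \<xi> A B \<eta> w"
proof -
  have "0 \<le> symbol_matrix A B x" for x using assms by (cases x) auto
  then have "0 \<le> word_matrix A B w *v \<eta>"
    by (induction w) (auto simp: assms matrix_vector_mul_assoc[symmetric] intro!: matrix_vector_nonneg)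
  then show ?thesis unfolding word_weight_def by (rule inner_nonneg[OF assms(1)])
qed

lemma inner_matrix_power_total:
  "\<xi> \<bullet> (matrix_power (tilted_matrix A B t) n *v \<eta>) =
     (\<Sum>w\<in>words n. word_weight \<xi> A B \<eta> w * exp (t \<bullet> symbol_counts w))"
  by (simp add: sum_words_tilted[symmetric] inner_sum_right word_weight_def mult.commute)

text \<open>Valid for every \<open>n\<close>: if the normalising constant vanishes, both sides are 0
  by division by zero. Nonnegativity of the weights makes the passage through \<open>ennreal\<close>
  harmless.\<close>

lemma symbol_mgf_eq:
  assumes "0 \<le> \<xi>" "0 \<le> \<eta>" "\<And>i. 0 \<le> A i" "0 \<le> B"
  shows "symbol_mgf \<xi> A B \<eta> n t =
    (\<xi> \<bullet> (matrix_power (tilted_matrix A B t) n *v \<eta>)) /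
    (\<xi> \<bullet> (matrix_power (tilted_matrix A B 0) n *v \<eta>))"
proof -
  note nn = word_weight_nonneg[OF assms]
  define Z where "Z = \<xi> \<bullet> (matrix_power (tilted_matrix A B 0) n *v \<eta>)"
  have Z: "Z \<ge> 0" unfolding Z_def inner_matrix_power_total by (intro sum_nonneg) (simp add: nn)
  have "symbol_mgf \<xi> A B \<eta> n t =
      (\<Sum>w\<in>words n. (word_weight \<xi> A B \<eta> w / Z) *\<^sub>R exp (t \<bullet> symbol_counts w))"
    unfolding symbol_mgf_def word_measure_def tilted_matrix_0[symmetric] Z_def[symmetric]
    by (rule lebesgue_integral_point_measure_finite) (simp_all add: finite_words nn Z)
  then show ?thesis
    unfolding inner_matrix_power_total[of _ _ _ t] Z_def[symmetric] by (simp add: sum_divide_distrib)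
qed

lemma tilted_matrix_component:
  "tilted_matrix A B t $ i $ j = (\<Sum>k\<in>UNIV. exp (t $ k) * A k $ i $ j) + B $ i $ j"
  by (simp add: tilted_matrix_def sum_component)

text \<open>A positive constant \<open>c\<close> below all exponential factors gives c M \<le> M(t)
  entrywise, hence c^n M^n \<le> M(t)^n, so the exponent that witnesses primitivity of M also works
  for M(t).\<close>

lemma primitive_tilted:
  fixes A :: "'l::finite \<Rightarrow> real^'m^'m"
  assumes A: "\<And>i. 0 \<le> A i" and B: "0 \<le> B" and prim: "primitive_matrix (total_matrix A B)"
  shows "primitive_matrix (tilted_matrix A B t)"
proof -
  obtain k where k: "k \<ge> 1" "\<And>i j. matrix_power (total_matrix A B) k $ i $ j > 0"
    using prim unfolding primitive_matrix_def by auto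
  have A0: "A l $ i $ j \<ge> 0" and B0: "B $ i $ j \<ge> 0" for l i j
    using A[of l] B by (auto simp: less_eq_vec_def)
  \<comment> \<open>The inserted 1 is the factor of b; it also makes
    \<open>c \<le> 1\<close>.\<close>
  define c where "c = Min (insert 1 (range (\<lambda>i. exp (t $ i))))"
  have c: "c > 0" "c \<le> 1" "\<And>i. c \<le> exp (t $ i)"
    unfolding c_def by (auto intro: Min_le simp del: Min_insert)
  have le: "c * total_matrix A B $ i $ j \<le> tilted_matrix A B t $ i $ j" for i j
    using c A0 B0 unfolding tilted_matrix_0[symmetric] tilted_matrix_component distrib_left sum_distrib_left
    by (intro add_mono sum_mono) (auto intro: mult_right_mono mult_left_le_one_le)
  have nn: "0 \<le> tilted_matrix A B t" "0 \<le> total_matrix A B"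
    using A0 B0 unfolding tilted_matrix_0[symmetric]
    by (auto simp: less_eq_vec_def tilted_matrix_component intro!: add_nonneg_nonneg sum_nonneg)
  have "c ^ n * matrix_power (total_matrix A B) n $ i $ j \<le> matrix_power (tilted_matrix A B t) n $ i $ j" for n i j
  proof (induction n arbitrary: i j)
    case (Suc n)
    have "c ^ Suc n * matrix_power (total_matrix A B) (Suc n) $ i $ j =
      (\<Sum>l\<in>UNIV. (c * total_matrix A B $ i $ l) * (c ^ n * matrix_power (total_matrix A B) n $ l $ j))"
      by (simp add: matrix_matrix_mult_def sum_distrib_left mult_ac)
    also have "\<dots> \<le> (\<Sum>l\<in>UNIV. tilted_matrix A B t $ i $ l * matrix_power (tilted_matrix A B t) n $ l $ j)"
      using Suc le c nn matrix_power_nonneg[OF nn(2)]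
      by (intro sum_mono mult_mono) (auto simp: less_eq_vec_def)
    finally show ?case by (simp add: matrix_matrix_mult_def)
  qed simp
  then have "matrix_power (tilted_matrix A B t) k $ i $ j > 0" for i j
    using k(2)[of i j] c(1) by (meson mult_pos_pos order_less_le_trans zero_less_power)
  with nn k(1) show ?thesis unfolding primitive_matrix_def by blast
qed

section \<open>Analyticity of the leading coefficient\<close>

lemma analytic_at_0_inner:
  fixes U V :: "real^'l::finite \<Rightarrow> real^'m"
  assumes "\<And>i. analytic_at_0 (\<lambda>h. U h $ i)" "\<And>i. analytic_at_0 (\<lambda>h. V h $ i)"
  shows "analytic_at_0 (\<lambda>h. U h \<bullet> V h)"
  unfolding inner_vec_def by (simp add: analytic_at_0_sum analytic_at_0_mult assms)

definition perron_coefficient :: "real^'m \<Rightarrow> real^'m \<Rightarrow> real^'m \<Rightarrow> real^'m \<Rightarrow> real" where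
  "perron_coefficient \<xi> \<eta> v u = (\<xi> \<bullet> v) * (u \<bullet> \<eta>) / (u \<bullet> v)"

lemma perron_coefficient_scale:
  assumes "a \<noteq> 0" "b \<noteq> 0"
  shows "perron_coefficient \<xi> \<eta> (a *\<^sub>R v) (b *\<^sub>R u) = perron_coefficient \<xi> \<eta> v u"
  using assms by (simp add: perron_coefficient_def)

text \<open>The vectors \<open>v h\<close> and \<open>u h\<close> come from an arbitrary choice for
  each \<open>h\<close>, with no regularity in \<open>h\<close>. Analytic eigenvectors
  \<open>V\<close> and \<open>U\<close>, found separately for \<open>M\<close> and its transpose,
  are multiples of them on a small cube, and the multiples cancel in the coefficient.\<close>

lemma analytic_at_0_perron_coefficient:
  fixes M :: "real^'l::finite \<Rightarrow> real^'m^'m"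
  assumes M: "\<And>i j. analytic_at_0 (\<lambda>h. M h $ i $ j)"
    and pt: "\<And>h. perron_triple (M h) (y h) (v h) (u h)"
  shows "analytic_at_0 (\<lambda>h. perron_coefficient \<xi> \<eta> (v h) (u h))"
proof -
  obtain N V \<rho>1 where N: "N \<ge> 1" and V: "\<And>i. analytic_at_0 (\<lambda>h. V h $ i)" "V 0 = v 0" and \<rho>1: "\<rho>1 > 0"
    and V1: "\<And>h. h \<in> cube \<rho>1 \<Longrightarrow> (\<forall>i. V h $ i > 0) \<and> (\<exists>\<kappa>. matrix_power (M h) N *v V h = \<kappa> *\<^sub>R V h)"
    using analytic_at_0_perron_eigenvector[OF M pt] by blast
  have Mt: "analytic_at_0 (\<lambda>h. transpose (M h) $ i $ j)" for i j using M by (simp add: transpose_def)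
  obtain N' U \<rho>2 where N': "N' \<ge> 1" and U: "\<And>i. analytic_at_0 (\<lambda>h. U h $ i)" "U 0 = u 0" and \<rho>2: "\<rho>2 > 0"
    and U1: "\<And>h. h \<in> cube \<rho>2 \<Longrightarrow> (\<forall>i. U h $ i > 0) \<and> (\<exists>\<kappa>. matrix_power (transpose (M h)) N' *v U h = \<kappa> *\<^sub>R U h)"
    using analytic_at_0_perron_eigenvector[OF Mt perron_triple_transpose[OF pt]] by blast
  have "U 0 \<bullet> V 0 \<noteq> 0"
    using pt[of 0] inner_pos[of "u 0" "v 0"] by (simp add: U V perron_triple_def)
  then have "analytic_at_0 (\<lambda>h. (\<xi> \<bullet> V h) * (U h \<bullet> \<eta>) * inverse (U h \<bullet> V h))"
    by (intro analytic_at_0_mult analytic_at_0_inverse analytic_at_0_inner analytic_at_0_const U V)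
  then show ?thesis
  proof (rule analytic_at_0_cong)
    show "min \<rho>1 \<rho>2 > 0" using \<rho>1 \<rho>2 by simp
    fix h :: "real^'l" assume "h \<in> cube (min \<rho>1 \<rho>2)"
    then have h: "h \<in> cube \<rho>1" "h \<in> cube \<rho>2" by (auto simp: cube_def)
    obtain a where a: "V h = a *\<^sub>R v h"
      using V1[OF h(1)] perron_eigenvector_unique[OF pt N] by blast
    obtain b where b: "U h = b *\<^sub>R u h"
      using U1[OF h(2)] perron_eigenvector_unique[OF perron_triple_transpose[OF pt] N'] by blast
    have "V h \<noteq> 0" "U h \<noteq> 0" using V1[OF h(1)] U1[OF h(2)] by (metis less_irrefl zero_index)+
    then have ab: "a \<noteq> 0" "b \<noteq> 0" using a b by auto
    have "(\<xi> \<bullet> V h) * (U h \<bullet> \<eta>) * inverse (U h \<bullet> V h) = perron_coefficient \<xi> \<eta> (V h) (U h)"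
      by (simp add: perron_coefficient_def divide_inverse)
    also have "\<dots> = perron_coefficient \<xi> \<eta> (v h) (u h)"
      unfolding a b by (rule perron_coefficient_scale[OF ab])
    finally show "(\<xi> \<bullet> V h) * (U h \<bullet> \<eta>) * inverse (U h \<bullet> V h) = perron_coefficient \<xi> \<eta> (v h) (u h)" .
  qed
qed

text \<open>The identity is stated only eventually, since \<open>c' + e' n\<close> may vanish for
  small \<open>n\<close>. The slower of the two decay rates governs the quotient.\<close>

lemma quotient_asymptotics:
  fixes e e' :: "nat \<Rightarrow> real"
  assumes c: "c > 0" "c' > 0" and \<epsilon>: "0 < \<epsilon>" "\<epsilon> < 1" "0 < \<epsilon>'" "\<epsilon>' < 1"
    and e: "\<And>n. \<bar>e n\<bar> \<le> D * \<epsilon> ^ n" and e': "\<And>n. \<bar>e' n\<bar> \<le> D' * \<epsilon>' ^ n"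
  shows "\<exists>\<delta>. 0 < \<delta> \<and> \<delta> < 1 \<and> (\<exists>g :: nat \<Rightarrow> real. g \<in> O(\<lambda>n. \<delta> ^ n) \<and>
    (\<forall>\<^sub>F n in sequentially. (c + e n) / (c' + e' n) = c / c' * (1 + g n)))"
proof -
  define \<delta> where "\<delta> = max \<epsilon> \<epsilon>'"
  have \<delta>: "0 < \<delta>" "\<delta> < 1" using \<epsilon> by (auto simp: \<delta>_def)
  have D: "D \<ge> 0" "D' \<ge> 0" using e[of 0] e'[of 0] by auto
  have eb: "\<bar>e n\<bar> \<le> D * \<delta> ^ n" for n
    by (rule order_trans[OF e]) (use D \<epsilon> in \<open>auto simp: \<delta>_def intro!: mult_left_mono power_mono\<close>)
  have eb': "\<bar>e' n\<bar> \<le> D' * \<delta> ^ n" for n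
    by (rule order_trans[OF e']) (use D \<epsilon> in \<open>auto simp: \<delta>_def intro!: mult_left_mono power_mono\<close>)
  have "(\<lambda>n. D' * \<delta> ^ n) \<longlonglongrightarrow> D' * 0"
    using \<delta> by (intro tendsto_intros LIMSEQ_power_zero) auto
  \<comment> \<open>From here on the denominator \<open>c' + e' n\<close> is at least
    \<open>c' / 2\<close>.\<close>
  then have ev: "\<forall>\<^sub>F n in sequentially. D' * \<delta> ^ n < c' / 2"
    using c by (intro order_tendstoD(2)[of _ "D' * 0"]) auto
  \<comment> \<open>The relative error, obtained by solving the claimed identity for
    \<open>g n\<close>.\<close>
  define g where "g n = (c' * e n - c * e' n) / (c * (c' + e' n))" for n
  have "g \<in> O(\<lambda>n. \<delta> ^ n)"
  proof (rule bigoI)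
    show "\<forall>\<^sub>F n in sequentially. norm (g n) \<le> (c' * D + c * D') / (c * (c' / 2)) * norm (\<delta> ^ n)"
      using ev
    proof eventually_elim
      case (elim n)
      have low: "c' / 2 \<le> c' + e' n" using elim eb'[of n] by linarith
      have "norm (g n) = \<bar>c' * e n - c * e' n\<bar> / (c * (c' + e' n))"
        using low c by (simp add: g_def abs_mult)
      also have "\<dots> \<le> (c' * (D * \<delta> ^ n) + c * (D' * \<delta> ^ n)) / (c * (c' / 2))"
      proof (rule frac_le)
        have "\<bar>c' * e n - c * e' n\<bar> \<le> c' * \<bar>e n\<bar> + c * \<bar>e' n\<bar>"
          using c abs_triangle_ineq4[of "c' * e n" "c * e' n"] by (simp add: abs_mult)
        also have "\<dots> \<le> c' * (D * \<delta> ^ n) + c * (D' * \<delta> ^ n)"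
          using c eb[of n] eb'[of n] by (intro add_mono mult_left_mono) auto
        finally show "\<bar>c' * e n - c * e' n\<bar> \<le> c' * (D * \<delta> ^ n) + c * (D' * \<delta> ^ n)" .
      qed (use c D \<delta> low in auto)
      also have "\<dots> = (c' * D + c * D') / (c * (c' / 2)) * norm (\<delta> ^ n)"
        using \<delta> by (simp add: algebra_simps)
      finally show ?case .
    qed
  qed
  moreover have "\<forall>\<^sub>F n in sequentially. (c + e n) / (c' + e' n) = c / c' * (1 + g n)"
    using ev
  proof eventually_elim
    case (elim n)
    then have "c' + e' n > 0" using eb'[of n] c by linarith
    then have nz: "c * (c' + e' n) \<noteq> 0" using c by simp
    have "1 + g n = (c * (c' + e' n) + (c' * e n - c * e' n)) / (c * (c' + e' n))"
      by (simp only: g_def add_divide_distrib divide_self[OF nz])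
    also have "\<dots> = c' * (c + e n) / (c * (c' + e' n))" by (simp add: algebra_simps)
    finally show ?case using c by simp
  qed
  ultimately show ?thesis using \<delta> by blast
qed

theorem theorem2:
  fixes \<xi> \<eta> :: "real^'m"
    and A :: "'l::finite \<Rightarrow> real^'m^'m"
    and B :: "real^'m^'m"
  assumes "0 \<le> \<xi>" and "0 \<le> \<eta>" and "\<And>i. 0 \<le> A i" and "0 \<le> B"
    and "\<And>i. A i \<noteq> 0" and "B \<noteq> 0"
    and "\<forall>\<^sub>F n in sequentially. \<exists>w\<in>words n. word_weight \<xi> A B \<eta> w > 0"
    and "primitive_matrix (total_matrix A B)"
  shows "\<exists>r :: real^'l \<Rightarrow> real.
    real_analytic r \<and> (\<forall>t. r t > 0) \<and> r 0 = 1 \<and>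
    (\<forall>t. \<exists>\<epsilon>. 0 < \<epsilon> \<and> \<epsilon> < 1 \<and>
      (\<exists>g :: nat \<Rightarrow> real. g \<in> O(\<lambda>n. \<epsilon> ^ n) \<and>
        (\<forall>\<^sub>F n in sequentially.
          symbol_mgf \<xi> A B \<eta> n t =
            r t * (perron_frobenius_eigenvalue (tilted_matrix A B t) /
                   perron_frobenius_eigenvalue (total_matrix A B)) ^ n * (1 + g n))))"
proof -
  let ?M = "tilted_matrix A B"
  have "\<forall>t. \<exists>p. case p of (y, v, u) \<Rightarrow> perron_triple (?M t) y v u"
    using perron_triple_exists[OF primitive_tilted[OF assms(3,4,8)]] by fast
  then obtain p where p: "\<And>t. case p t of (y, v, u) \<Rightarrow> perron_triple (?M t) y v u"
    unfolding choice_iff by blast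
  define y v u where "y t = fst (p t)" and "v t = fst (snd (p t))" and "u t = snd (snd (p t))" for t
  have pt: "perron_triple (?M t) (y t) (v t) (u t)" for t
    using p[of t] by (simp add: y_def v_def u_def case_prod_unfold)
  define c where "c t = perron_coefficient \<xi> \<eta> (v t) (u t)" for t
  \<comment> \<open>A single word of positive weight rules out zero vectors; with the positivity of
    the eigenvectors this makes \<open>c t\<close> positive.\<close>
  have "\<xi> \<noteq> 0" "\<eta> \<noteq> 0"
    using eventually_happens[OF assms(7)] by (auto simp: word_weight_def)
  then have c: "c t > 0" for t
    using pt[of t] inner_pos[of "u t" "v t"] inner_pos_nonneg[of "v t" \<xi>] inner_pos_nonneg[of "u t" \<eta>] assms(1,2)
    by (simp add: c_def perron_coefficient_def perron_triple_def inner_commute)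
  \<comment> \<open>Analyticity at \<open>x\<close> is the germ statement for the translated family
    of matrices M(x + h).\<close>
  have "analytic_at_0 (\<lambda>h. c (x + h))" for x
    unfolding c_def
  proof (rule analytic_at_0_perron_coefficient[OF _ pt])
    show "analytic_at_0 (\<lambda>h. ?M (x + h) $ i $ j)" for i j
      unfolding tilted_matrix_component vector_add_component
      by (intro analytic_at_0_add analytic_at_0_sum analytic_at_0_mult analytic_at_0_exp analytic_at_0_const analytic_at_0_coord)
  qed
  then have "real_analytic (\<lambda>t. c t / c 0)"
    unfolding divide_inverse by (intro analytic_at_0_real_analytic analytic_at_0_mult analytic_at_0_const)
  moreover have "\<exists>\<epsilon>. 0 < \<epsilon> \<and> \<epsilon> < 1 \<and>
      (\<exists>g :: nat \<Rightarrow> real. g \<in> O(\<lambda>n. \<epsilon> ^ n) \<and>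
        (\<forall>\<^sub>F n in sequentially.
          symbol_mgf \<xi> A B \<eta> n t =
            c t / c 0 * (perron_frobenius_eigenvalue (?M t) /
                   perron_frobenius_eigenvalue (total_matrix A B)) ^ n * (1 + g n)))" for t
  proof -
    obtain \<epsilon>1 D1 e1 where \<epsilon>1: "0 < \<epsilon>1" "\<epsilon>1 < 1" and e1: "\<And>n. \<bar>e1 n\<bar> \<le> D1 * \<epsilon>1 ^ n"
      and eq1: "\<And>n. \<xi> \<bullet> (matrix_power (?M t) n *v \<eta>) = y t ^ n * (c t + e1 n)"
      using perron_asymptotics[OF pt[of t], of \<xi> \<eta>, folded perron_coefficient_def c_def] by blast
    obtain \<epsilon>2 D2 e2 where \<epsilon>2: "0 < \<epsilon>2" "\<epsilon>2 < 1" and e2: "\<And>n. \<bar>e2 n\<bar> \<le> D2 * \<epsilon>2 ^ n"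
      and eq2: "\<And>n. \<xi> \<bullet> (matrix_power (?M 0) n *v \<eta>) = y 0 ^ n * (c 0 + e2 n)"
      using perron_asymptotics[OF pt[of 0], of \<xi> \<eta>, folded perron_coefficient_def c_def] by blast
    obtain \<delta> g where \<delta>: "0 < \<delta>" "\<delta> < 1" and g: "g \<in> O(\<lambda>n. \<delta> ^ n)"
      and quot: "\<forall>\<^sub>F n in sequentially. (c t + e1 n) / (c 0 + e2 n) = c t / c 0 * (1 + g n)"
      using quotient_asymptotics[OF c c \<epsilon>1 \<epsilon>2 e1 e2] by blast
    have mgf: "symbol_mgf \<xi> A B \<eta> n t = (y t / y 0) ^ n * ((c t + e1 n) / (c 0 + e2 n))" for n
      unfolding symbol_mgf_eq[OF assms(1-4)] eq1 eq2 by (simp add: power_divide)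
    have pf: "perron_frobenius_eigenvalue (?M t) = y t"
      "perron_frobenius_eigenvalue (total_matrix A B) = y 0"
      using perron_frobenius_eigenvalue_eq[OF pt] by (simp_all flip: tilted_matrix_0)
    have "\<forall>\<^sub>F n in sequentially. symbol_mgf \<xi> A B \<eta> n t =
            c t / c 0 * (perron_frobenius_eigenvalue (?M t) /
                   perron_frobenius_eigenvalue (total_matrix A B)) ^ n * (1 + g n)"
      using quot unfolding mgf pf by eventually_elim simp
    with \<delta> g show ?thesis by blast
  qed
  ultimately show ?thesis using c by (intro exI[of _ "\<lambda>t. c t / c 0"]) (auto simp: less_imp_neq[symmetric])
qed

end
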